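(* Let $\mathbb{K}$ be an infinite field, $R$ a $\mathbb{K}[q^{\pm1}]$-algebra, and $\epsilon\in\mathbb{K}^\times$ such that $q-\epsilon\in R$ is regular (not a zero divisor). Assume that $C_\epsilon$ is a Poisson subalgebra of the center of $R_\epsilon:=R/(q-\epsilon)R$ and that $R_\epsilon$ is equipped with a trace function $\mathrm{tr}:R_\epsilon\to C_\epsilon$ which commutes with all derivations $\partial$ of $R_\epsilon$ such that $\partial(C_\epsilon)\subseteq C_\epsilon$. Then, for all positive integers $n$, the discriminant ideal $D_n(R_\epsilon/C_\epsilon)$ is a Poisson ideal of $C_\epsilon$. Furthermore, $\partial(D_n(R_\epsilon/C_\epsilon))\subseteq D_n(R_\epsilon/C_\epsilon)$ for all derivations $\partial$ of $R_\epsilon$ such that $\partial(C_\epsilon)\subseteq C_\epsilon$.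
   Context: All algebras are unital; derivations are $\mathbb{K}$-linear. Let $\sigma:R\to R_\epsilon$ be the projection. The center $Z(R_\epsilon)$ is a Poisson algebra with $\{z_1,z_2\}:=\sigma\big(\tfrac{x_1x_2-x_2x_1}{q-\epsilon}\big)$ for any $x_i\in\sigma^{-1}(z_i)$ (well defined). A trace $\mathrm{tr}:S\to C$, for $C$ a subalgebra of the center of $S$, is a $C$-linear map with $\mathrm{tr}(xy)=\mathrm{tr}(yx)$ for all $x,y\in S$; it commutes with a derivation $\partial$ if $\mathrm{tr}(\partial x)=\partial(\mathrm{tr}(x))$ for all $x\in S$. For an $n$-element subset $\mathcal{Y}=\{y_1,\dots,y_n\}\subset S$ put $d_n(\mathcal{Y}:\mathrm{tr}):=\det([\mathrm{tr}(y_iy_j)]_{i,j=1}^n)\in C$; the $n$-discriminant ideal $D_n(S/C)$ is the ideal of $C$ generated by $d_n(\mathcal{Y}:\mathrm{tr})$ for all $n$-element subsets $\mathcal{Y}\subset S$. An ideal $I$ of a Poisson algebra $C$ is Poisson if $\{I,C\}\subseteq I$. *)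

theory Defs
  imports "HOL-Algebra.Algebra" "HOL-Combinatorics.Permutations"
begin

section \<open>Algebras over Laurent polynomials\<close>

text \<open>The ring \<open>K[q\<^sup>\<plusminus>\<^sup>1]\<close>: an element is its finitely supported family of coefficients,
  indexed by the integer exponents of \<open>q\<close>.\<close>

definition laurent_ring :: "('k, 'm) ring_scheme \<Rightarrow> (int \<Rightarrow> 'k) ring" where
  "laurent_ring K =
    \<lparr> carrier = {f. (\<forall>i. f i \<in> carrier K) \<and> finite {i. f i \<noteq> \<zero>\<^bsub>K\<^esub>}},
      monoid.mult = (\<lambda>f g k. \<Oplus>\<^bsub>K\<^esub>i\<in>{i. f i \<noteq> \<zero>\<^bsub>K\<^esub>}. f i \<otimes>\<^bsub>K\<^esub> g (k - i)),
      one = (\<lambda>k. if k = 0 then \<one>\<^bsub>K\<^esub> else \<zero>\<^bsub>K\<^esub>),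
      ring.zero = (\<lambda>k. \<zero>\<^bsub>K\<^esub>),
      ring.add = (\<lambda>f g k. f k \<oplus>\<^bsub>K\<^esub> g k) \<rparr>"

text \<open>The Laurent monomial \<open>a q\<^sup>n\<close>.\<close>

definition laurent_monom :: "('k, 'm) ring_scheme \<Rightarrow> 'k \<Rightarrow> int \<Rightarrow> int \<Rightarrow> 'k" where
  "laurent_monom K a n = (\<lambda>k. if k = n then a else \<zero>\<^bsub>K\<^esub>)"

definition ring_center :: "('a, 'm) ring_scheme \<Rightarrow> 'a set" where
  "ring_center S = {z \<in> carrier S. \<forall>x\<in>carrier S. z \<otimes>\<^bsub>S\<^esub> x = x \<otimes>\<^bsub>S\<^esub> z}"

text \<open>A unital associative, not necessarily commutative, algebra \<open>R\<close> over \<open>K[q\<^sup>\<plusminus>\<^sup>1]\<close> is given by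
  its structure map \<open>\<eta>\<close>, so that \<open>f \<cdot> x = \<eta> f \<otimes> x\<close>.\<close>

definition laurent_algebra ::
    "('k, 'm) ring_scheme \<Rightarrow> ('r, 'n) ring_scheme \<Rightarrow> ((int \<Rightarrow> 'k) \<Rightarrow> 'r) \<Rightarrow> bool" where
  "laurent_algebra K R \<eta> \<longleftrightarrow>
    ring R \<and> \<eta> \<in> ring_hom (laurent_ring K) R \<and>
    \<eta> ` carrier (laurent_ring K) \<subseteq> ring_center R"

definition regular_element :: "('r, 'n) ring_scheme \<Rightarrow> 'r \<Rightarrow> bool" where
  "regular_element R c \<longleftrightarrow> c \<in> carrier R \<and>
    (\<forall>x\<in>carrier R. c \<otimes>\<^bsub>R\<^esub> x = \<zero>\<^bsub>R\<^esub> \<or> x \<otimes>\<^bsub>R\<^esub> c = \<zero>\<^bsub>R\<^esub> \<longrightarrow> x = \<zero>\<^bsub>R\<^esub>)"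

section \<open>Specialization\<close>

text \<open>The element \<open>q - \<epsilon>\<close> of \<open>R\<close>.\<close>

definition q_minus ::
    "('k, 'm) ring_scheme \<Rightarrow> ('r, 'n) ring_scheme \<Rightarrow> ((int \<Rightarrow> 'k) \<Rightarrow> 'r) \<Rightarrow> 'k \<Rightarrow> 'r" where
  "q_minus K R \<eta> \<epsilon> = \<eta> (laurent_monom K \<one>\<^bsub>K\<^esub> 1) \<ominus>\<^bsub>R\<^esub> \<eta> (laurent_monom K \<epsilon> 0)"

text \<open>For central \<open>c\<close>, the two-sided ideal \<open>cR\<close>, the quotient \<open>R/cR\<close> and the projection onto it;
  these are used with \<open>c = q - \<epsilon>\<close>.\<close>

definition multiples :: "('r, 'n) ring_scheme \<Rightarrow> 'r \<Rightarrow> 'r set" where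
  "multiples R c = (\<lambda>x. c \<otimes>\<^bsub>R\<^esub> x) ` carrier R"

definition specialization :: "('r, 'n) ring_scheme \<Rightarrow> 'r \<Rightarrow> 'r set ring" where
  "specialization R c = R Quot (multiples R c)"

definition spec_proj :: "('r, 'n) ring_scheme \<Rightarrow> 'r \<Rightarrow> 'r \<Rightarrow> 'r set" where
  "spec_proj R c x = multiples R c +>\<^bsub>R\<^esub> x"

text \<open>The structure map of \<open>R/(q - \<epsilon>)R\<close> as a \<open>K\<close>-algebra.\<close>

definition spec_scalar ::
    "('k, 'm) ring_scheme \<Rightarrow> ('r, 'n) ring_scheme \<Rightarrow> ((int \<Rightarrow> 'k) \<Rightarrow> 'r) \<Rightarrow> 'k \<Rightarrow> 'k \<Rightarrow> 'r set" where
  "spec_scalar K R \<eta> \<epsilon> a = spec_proj R (q_minus K R \<eta> \<epsilon>) (\<eta> (laurent_monom K a 0))"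

text \<open>The bracket \<open>{z1, z2} = \<sigma> ((x1 x2 - x2 x1) / c)\<close> on the center of \<open>R/cR\<close>, for arbitrary lifts
  \<open>x1\<close>, \<open>x2\<close>; the element \<open>y\<close> below is the quotient by \<open>c\<close>. Independence of all choices, for \<open>c\<close>
  central and regular, is \<open>spec_bracket_unique\<close> below.\<close>

definition spec_bracket :: "('r, 'n) ring_scheme \<Rightarrow> 'r \<Rightarrow> 'r set \<Rightarrow> 'r set \<Rightarrow> 'r set" where
  "spec_bracket R c z1 z2 = (THE w. \<exists>x1\<in>carrier R. \<exists>x2\<in>carrier R. \<exists>y\<in>carrier R.
      spec_proj R c x1 = z1 \<and> spec_proj R c x2 = z2 \<and>
      x1 \<otimes>\<^bsub>R\<^esub> x2 \<ominus>\<^bsub>R\<^esub> x2 \<otimes>\<^bsub>R\<^esub> x1 = c \<otimes>\<^bsub>R\<^esub> y \<and> w = spec_proj R c y)"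

section \<open>Poisson subalgebras, traces, derivations\<close>

text \<open>In this section \<open>S\<close> is a \<open>K\<close>-algebra with structure map \<open>\<iota>\<close>.\<close>

definition central_poisson_subalgebra ::
    "('k, 'm) ring_scheme \<Rightarrow> ('a, 'n) ring_scheme \<Rightarrow> ('k \<Rightarrow> 'a) \<Rightarrow> ('a \<Rightarrow> 'a \<Rightarrow> 'a) \<Rightarrow> 'a set \<Rightarrow> bool"
  where
  "central_poisson_subalgebra K S \<iota> br C \<longleftrightarrow>
    subring C S \<and> \<iota> ` carrier K \<subseteq> C \<and> C \<subseteq> ring_center S \<and> (\<forall>a\<in>C. \<forall>b\<in>C. br a b \<in> C)"

definition poisson_ideal ::
    "('a, 'n) ring_scheme \<Rightarrow> ('a \<Rightarrow> 'a \<Rightarrow> 'a) \<Rightarrow> 'a set \<Rightarrow> 'a set \<Rightarrow> bool" where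
  "poisson_ideal S br C I \<longleftrightarrow>
    ideal I (S\<lparr>carrier := C\<rparr>) \<and> (\<forall>a\<in>I. \<forall>b\<in>C. br a b \<in> I)"

definition derivation ::
    "('k, 'm) ring_scheme \<Rightarrow> ('a, 'n) ring_scheme \<Rightarrow> ('k \<Rightarrow> 'a) \<Rightarrow> ('a \<Rightarrow> 'a) \<Rightarrow> bool" where
  "derivation K S \<iota> D \<longleftrightarrow>
    D \<in> carrier S \<rightarrow> carrier S \<and>
    (\<forall>x\<in>carrier S. \<forall>y\<in>carrier S. D (x \<oplus>\<^bsub>S\<^esub> y) = D x \<oplus>\<^bsub>S\<^esub> D y) \<and>
    (\<forall>a\<in>carrier K. \<forall>x\<in>carrier S. D (\<iota> a \<otimes>\<^bsub>S\<^esub> x) = \<iota> a \<otimes>\<^bsub>S\<^esub> D x) \<and>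
    (\<forall>x\<in>carrier S. \<forall>y\<in>carrier S. D (x \<otimes>\<^bsub>S\<^esub> y) = D x \<otimes>\<^bsub>S\<^esub> y \<oplus>\<^bsub>S\<^esub> x \<otimes>\<^bsub>S\<^esub> D y)"

definition trace_function :: "('a, 'n) ring_scheme \<Rightarrow> 'a set \<Rightarrow> ('a \<Rightarrow> 'a) \<Rightarrow> bool" where
  "trace_function S C tr \<longleftrightarrow>
    tr \<in> carrier S \<rightarrow> C \<and>
    (\<forall>x\<in>carrier S. \<forall>y\<in>carrier S. tr (x \<oplus>\<^bsub>S\<^esub> y) = tr x \<oplus>\<^bsub>S\<^esub> tr y) \<and>
    (\<forall>c\<in>C. \<forall>x\<in>carrier S. tr (c \<otimes>\<^bsub>S\<^esub> x) = c \<otimes>\<^bsub>S\<^esub> tr x) \<and>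
    (\<forall>x\<in>carrier S. \<forall>y\<in>carrier S. tr (x \<otimes>\<^bsub>S\<^esub> y) = tr (y \<otimes>\<^bsub>S\<^esub> x))"

definition commutes_with_trace ::
    "('a, 'n) ring_scheme \<Rightarrow> ('a \<Rightarrow> 'a) \<Rightarrow> ('a \<Rightarrow> 'a) \<Rightarrow> bool" where
  "commutes_with_trace S tr D \<longleftrightarrow> (\<forall>x\<in>carrier S. tr (D x) = D (tr x))"

section \<open>Discriminant ideals\<close>

text \<open>Leibniz determinant over a commutative ring given by a carrier; the library determinants are
  for matrices over a type class.\<close>

definition ring_det :: "('a, 'n) ring_scheme \<Rightarrow> nat \<Rightarrow> (nat \<Rightarrow> nat \<Rightarrow> 'a) \<Rightarrow> 'a" where
  "ring_det C n A =
    (\<Oplus>\<^bsub>C\<^esub>p\<in>{p. p permutes {..<n}}. [sign p] \<cdot>\<^bsub>C\<^esub> (\<Otimes>\<^bsub>C\<^esub>i\<in>{..<n}. A i (p i)))"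

text \<open>An \<open>n\<close>-element subset is presented by an injective enumeration \<open>y 0, \<dots>, y (n - 1)\<close>; the
  determinant does not depend on the enumeration.\<close>

definition discriminant ::
    "('a, 'n) ring_scheme \<Rightarrow> 'a set \<Rightarrow> ('a \<Rightarrow> 'a) \<Rightarrow> nat \<Rightarrow> (nat \<Rightarrow> 'a) \<Rightarrow> 'a" where
  "discriminant S C tr n y = ring_det (S\<lparr>carrier := C\<rparr>) n (\<lambda>i j. tr (y i \<otimes>\<^bsub>S\<^esub> y j))"

definition discriminant_ideal ::
    "('a, 'n) ring_scheme \<Rightarrow> 'a set \<Rightarrow> ('a \<Rightarrow> 'a) \<Rightarrow> nat \<Rightarrow> 'a set" where
  "discriminant_ideal S C tr n =
    Idl\<^bsub>S\<lparr>carrier := C\<rparr>\<^esub> {discriminant S C tr n y | y. y ` {..<n} \<subseteq> carrier S \<and> inj_on y {..<n}}"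

section \<open>The bracket is well defined\<close>

lemma multiples_ideal:
  assumes "ring R" "c \<in> ring_center R"
  shows "ideal (multiples R c) R"
proof -
  interpret ring R by fact
  have c: "c \<in> carrier R" and comm: "\<And>x. x \<in> carrier R \<Longrightarrow> c \<otimes>\<^bsub>R\<^esub> x = x \<otimes>\<^bsub>R\<^esub> c"
    using assms(2) by (auto simp: ring_center_def)
  show ?thesis
  proof (rule idealI)
    show "ring R" by fact
    show "subgroup (multiples R c) (add_monoid R)"
    proof (rule add.subgroupI)
      show "multiples R c \<subseteq> carrier R" "multiples R c \<noteq> {}"
        using c by (auto simp: multiples_def)
    next
      fix a assume "a \<in> multiples R c"
      then obtain x where x: "x \<in> carrier R" "a = c \<otimes>\<^bsub>R\<^esub> x" by (auto simp: multiples_def)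
      then have "\<ominus>\<^bsub>R\<^esub> a = c \<otimes>\<^bsub>R\<^esub> (\<ominus>\<^bsub>R\<^esub> x)" using c by (simp add: r_minus)
      then show "\<ominus>\<^bsub>R\<^esub> a \<in> multiples R c" using x by (auto simp: multiples_def)
    next
      fix a b assume "a \<in> multiples R c" "b \<in> multiples R c"
      then obtain x y where x: "x \<in> carrier R" "a = c \<otimes>\<^bsub>R\<^esub> x" and y: "y \<in> carrier R" "b = c \<otimes>\<^bsub>R\<^esub> y"
        by (auto simp: multiples_def)
      then have "a \<oplus>\<^bsub>R\<^esub> b = c \<otimes>\<^bsub>R\<^esub> (x \<oplus>\<^bsub>R\<^esub> y)" using c by (simp add: r_distr)
      then show "a \<oplus>\<^bsub>R\<^esub> b \<in> multiples R c" using x y by (auto simp: multiples_def)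
    qed
  next
    fix a x assume "a \<in> multiples R c" and x: "x \<in> carrier R"
    then obtain y where y: "y \<in> carrier R" "a = c \<otimes>\<^bsub>R\<^esub> y" by (auto simp: multiples_def)
    have "a \<otimes>\<^bsub>R\<^esub> x = c \<otimes>\<^bsub>R\<^esub> (y \<otimes>\<^bsub>R\<^esub> x)" using c x y by (simp add: m_assoc)
    then show "a \<otimes>\<^bsub>R\<^esub> x \<in> multiples R c" using x y by (auto simp: multiples_def)
    have "x \<otimes>\<^bsub>R\<^esub> a = c \<otimes>\<^bsub>R\<^esub> (x \<otimes>\<^bsub>R\<^esub> y)" using c x y comm[OF x] by (metis m_assoc)
    then show "x \<otimes>\<^bsub>R\<^esub> a \<in> multiples R c" using x y by (auto simp: multiples_def)
  qed
qed

lemma spec_proj_eq_iff: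
  assumes "ring R" "c \<in> ring_center R" "x \<in> carrier R" "y \<in> carrier R"
  shows "spec_proj R c x = spec_proj R c y \<longleftrightarrow> (\<exists>a\<in>carrier R. x = y \<oplus>\<^bsub>R\<^esub> c \<otimes>\<^bsub>R\<^esub> a)"
proof -
  interpret ring R by fact
  interpret I: ideal "multiples R c" R by (rule multiples_ideal) fact+
  have c: "c \<in> carrier R" using assms(2) by (auto simp: ring_center_def)
  have "spec_proj R c x = spec_proj R c y \<longleftrightarrow> x \<ominus>\<^bsub>R\<^esub> y \<in> multiples R c"
    unfolding spec_proj_def using assms(3,4) I.ideal_axioms
    by (simp add: quotient_eq_iff_same_a_r_cos)
  also have "\<dots> \<longleftrightarrow> (\<exists>a\<in>carrier R. x = y \<oplus>\<^bsub>R\<^esub> c \<otimes>\<^bsub>R\<^esub> a)"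
  proof -
    have "x \<ominus>\<^bsub>R\<^esub> y = d \<longleftrightarrow> x = y \<oplus>\<^bsub>R\<^esub> d" if "d \<in> carrier R" for d
    proof
      assume "x \<ominus>\<^bsub>R\<^esub> y = d"
      moreover have "x = y \<oplus>\<^bsub>R\<^esub> (x \<ominus>\<^bsub>R\<^esub> y)" using assms(3,4) by algebra
      ultimately show "x = y \<oplus>\<^bsub>R\<^esub> d" by simp
    next
      assume "x = y \<oplus>\<^bsub>R\<^esub> d"
      moreover have "(y \<oplus>\<^bsub>R\<^esub> d) \<ominus>\<^bsub>R\<^esub> y = d" using assms(4) that by algebra
      ultimately show "x \<ominus>\<^bsub>R\<^esub> y = d" by simp
    qed
    then show ?thesis unfolding multiples_def image_iff using m_closed[OF c] by blast
  qed
  finally show ?thesis .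
qed

lemma spec_commutator:
  assumes "ring R" "c \<in> ring_center R" "x \<in> carrier R" "y \<in> carrier R"
    and "spec_proj R c x \<in> ring_center (specialization R c)"
  shows "\<exists>a\<in>carrier R. x \<otimes>\<^bsub>R\<^esub> y \<ominus>\<^bsub>R\<^esub> y \<otimes>\<^bsub>R\<^esub> x = c \<otimes>\<^bsub>R\<^esub> a"
proof -
  interpret ring R by fact
  interpret I: ideal "multiples R c" R by (rule multiples_ideal) fact+
  have c: "c \<in> carrier R" using assms(2) by (auto simp: ring_center_def)
  have hom: "spec_proj R c \<in> ring_hom R (specialization R c)"
    using I.rcos_ring_hom unfolding specialization_def spec_proj_def .
  have "spec_proj R c (x \<otimes>\<^bsub>R\<^esub> y) = spec_proj R c x \<otimes>\<^bsub>specialization R c\<^esub> spec_proj R c y"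
    using assms(3,4) hom by (simp add: ring_hom_mult)
  also have "\<dots> = spec_proj R c y \<otimes>\<^bsub>specialization R c\<^esub> spec_proj R c x"
    using assms(5) ring_hom_closed[OF hom assms(4)] by (simp add: ring_center_def)
  also have "\<dots> = spec_proj R c (y \<otimes>\<^bsub>R\<^esub> x)"
    using assms(3,4) hom by (simp add: ring_hom_mult)
  finally obtain a where a: "a \<in> carrier R" "x \<otimes>\<^bsub>R\<^esub> y = y \<otimes>\<^bsub>R\<^esub> x \<oplus>\<^bsub>R\<^esub> c \<otimes>\<^bsub>R\<^esub> a"
    using spec_proj_eq_iff[OF assms(1,2)] assms(3,4) by auto
  have "x \<otimes>\<^bsub>R\<^esub> y \<ominus>\<^bsub>R\<^esub> y \<otimes>\<^bsub>R\<^esub> x = c \<otimes>\<^bsub>R\<^esub> a"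
  proof -
    have "(u \<oplus>\<^bsub>R\<^esub> v) \<ominus>\<^bsub>R\<^esub> u = v" if "u \<in> carrier R" "v \<in> carrier R" for u v
      using that by algebra
    then show ?thesis using a c assms(3,4) by simp
  qed
  then show ?thesis using a(1) by blast
qed

lemma spec_bracket_unique:
  assumes "ring R" "c \<in> ring_center R" "regular_element R c"
    and "spec_proj R c x1 \<in> ring_center (specialization R c)"
    and "spec_proj R c x2 \<in> ring_center (specialization R c)"
    and x: "x1 \<in> carrier R" "x2 \<in> carrier R" and y: "y \<in> carrier R"
    and eq: "x1 \<otimes>\<^bsub>R\<^esub> x2 \<ominus>\<^bsub>R\<^esub> x2 \<otimes>\<^bsub>R\<^esub> x1 = c \<otimes>\<^bsub>R\<^esub> y"
  shows "spec_bracket R c (spec_proj R c x1) (spec_proj R c x2) = spec_proj R c y"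
  unfolding spec_bracket_def
proof (rule the_equality)
  show "\<exists>x1'\<in>carrier R. \<exists>x2'\<in>carrier R. \<exists>y'\<in>carrier R.
      spec_proj R c x1' = spec_proj R c x1 \<and> spec_proj R c x2' = spec_proj R c x2 \<and>
      x1' \<otimes>\<^bsub>R\<^esub> x2' \<ominus>\<^bsub>R\<^esub> x2' \<otimes>\<^bsub>R\<^esub> x1' = c \<otimes>\<^bsub>R\<^esub> y' \<and> spec_proj R c y = spec_proj R c y'"
    using x y eq by blast
next
  interpret ring R by fact
  have c: "c \<in> carrier R" and comm: "\<And>x. x \<in> carrier R \<Longrightarrow> x \<otimes>\<^bsub>R\<^esub> c = c \<otimes>\<^bsub>R\<^esub> x"
    using assms(2) by (auto simp: ring_center_def)
  fix w
  assume "\<exists>x1'\<in>carrier R. \<exists>x2'\<in>carrier R. \<exists>y'\<in>carrier R.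
      spec_proj R c x1' = spec_proj R c x1 \<and> spec_proj R c x2' = spec_proj R c x2 \<and>
      x1' \<otimes>\<^bsub>R\<^esub> x2' \<ominus>\<^bsub>R\<^esub> x2' \<otimes>\<^bsub>R\<^esub> x1' = c \<otimes>\<^bsub>R\<^esub> y' \<and> w = spec_proj R c y'"
  then obtain x1' x2' y' where x': "x1' \<in> carrier R" "x2' \<in> carrier R" "y' \<in> carrier R"
    and p: "spec_proj R c x1' = spec_proj R c x1" "spec_proj R c x2' = spec_proj R c x2"
    and eq': "x1' \<otimes>\<^bsub>R\<^esub> x2' \<ominus>\<^bsub>R\<^esub> x2' \<otimes>\<^bsub>R\<^esub> x1' = c \<otimes>\<^bsub>R\<^esub> y'"
    and w: "w = spec_proj R c y'" by blast
  obtain a where a: "a \<in> carrier R" "x1' = x1 \<oplus>\<^bsub>R\<^esub> c \<otimes>\<^bsub>R\<^esub> a"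
    using p(1) spec_proj_eq_iff[OF assms(1,2) x'(1) x(1)] by blast
  obtain b where b: "b \<in> carrier R" "x2' = x2 \<oplus>\<^bsub>R\<^esub> c \<otimes>\<^bsub>R\<^esub> b"
    using p(2) spec_proj_eq_iff[OF assms(1,2) x'(2) x(2)] by blast
  obtain d where d: "d \<in> carrier R" "x1 \<otimes>\<^bsub>R\<^esub> b \<ominus>\<^bsub>R\<^esub> b \<otimes>\<^bsub>R\<^esub> x1 = c \<otimes>\<^bsub>R\<^esub> d"
    using spec_commutator[OF assms(1,2) x(1) b(1) assms(4)] by blast
  obtain e where e: "e \<in> carrier R" "x2' \<otimes>\<^bsub>R\<^esub> a \<ominus>\<^bsub>R\<^esub> a \<otimes>\<^bsub>R\<^esub> x2' = c \<otimes>\<^bsub>R\<^esub> e"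
    using spec_commutator[OF assms(1,2) x'(2) a(1)] assms(5) p(2) by auto
  have 1: "(x1 \<oplus>\<^bsub>R\<^esub> c \<otimes>\<^bsub>R\<^esub> a) \<otimes>\<^bsub>R\<^esub> x2' = x1 \<otimes>\<^bsub>R\<^esub> x2' \<oplus>\<^bsub>R\<^esub> c \<otimes>\<^bsub>R\<^esub> (a \<otimes>\<^bsub>R\<^esub> x2')"
    using c a(1) x x' by (simp add: l_distr m_assoc)
  have 2: "x2' \<otimes>\<^bsub>R\<^esub> (x1 \<oplus>\<^bsub>R\<^esub> c \<otimes>\<^bsub>R\<^esub> a) = x2' \<otimes>\<^bsub>R\<^esub> x1 \<oplus>\<^bsub>R\<^esub> c \<otimes>\<^bsub>R\<^esub> (x2' \<otimes>\<^bsub>R\<^esub> a)"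
    using c a(1) x x' comm[OF x'(2)] by (metis r_distr m_assoc m_closed)
  have 3: "x1 \<otimes>\<^bsub>R\<^esub> x2' = x1 \<otimes>\<^bsub>R\<^esub> x2 \<oplus>\<^bsub>R\<^esub> c \<otimes>\<^bsub>R\<^esub> (x1 \<otimes>\<^bsub>R\<^esub> b)"
    unfolding b(2) using c b(1) x comm[OF x(1)] by (metis r_distr m_assoc m_closed)
  have 4: "x2' \<otimes>\<^bsub>R\<^esub> x1 = x2 \<otimes>\<^bsub>R\<^esub> x1 \<oplus>\<^bsub>R\<^esub> c \<otimes>\<^bsub>R\<^esub> (b \<otimes>\<^bsub>R\<^esub> x1)"
    unfolding b(2) using c b(1) x by (simp add: l_distr m_assoc)
  have rearr: "(p \<oplus>\<^bsub>R\<^esub> c \<otimes>\<^bsub>R\<^esub> r \<oplus>\<^bsub>R\<^esub> c \<otimes>\<^bsub>R\<^esub> s) \<ominus>\<^bsub>R\<^esub> (p' \<oplus>\<^bsub>R\<^esub> c \<otimes>\<^bsub>R\<^esub> r' \<oplus>\<^bsub>R\<^esub> c \<otimes>\<^bsub>R\<^esub> s')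
      = (p \<ominus>\<^bsub>R\<^esub> p') \<oplus>\<^bsub>R\<^esub> c \<otimes>\<^bsub>R\<^esub> ((r \<ominus>\<^bsub>R\<^esub> r') \<ominus>\<^bsub>R\<^esub> (s' \<ominus>\<^bsub>R\<^esub> s))"
    if "p \<in> carrier R" "p' \<in> carrier R" "r \<in> carrier R" "r' \<in> carrier R"
      "s \<in> carrier R" "s' \<in> carrier R" for p p' r r' s s'
    using that c by algebra
  have "c \<otimes>\<^bsub>R\<^esub> y' = (x1 \<otimes>\<^bsub>R\<^esub> x2 \<oplus>\<^bsub>R\<^esub> c \<otimes>\<^bsub>R\<^esub> (x1 \<otimes>\<^bsub>R\<^esub> b) \<oplus>\<^bsub>R\<^esub> c \<otimes>\<^bsub>R\<^esub> (a \<otimes>\<^bsub>R\<^esub> x2')) \<ominus>\<^bsub>R\<^esub>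
     (x2 \<otimes>\<^bsub>R\<^esub> x1 \<oplus>\<^bsub>R\<^esub> c \<otimes>\<^bsub>R\<^esub> (b \<otimes>\<^bsub>R\<^esub> x1) \<oplus>\<^bsub>R\<^esub> c \<otimes>\<^bsub>R\<^esub> (x2' \<otimes>\<^bsub>R\<^esub> a))"
    using eq' unfolding a(2) 1 2 unfolding 3 4 by simp
  also have "\<dots> = c \<otimes>\<^bsub>R\<^esub> y \<oplus>\<^bsub>R\<^esub> c \<otimes>\<^bsub>R\<^esub> (c \<otimes>\<^bsub>R\<^esub> d \<ominus>\<^bsub>R\<^esub> c \<otimes>\<^bsub>R\<^esub> e)"
    using a(1) b(1) x x' by (subst rearr) (simp_all add: eq d(2) e(2))
  finally have "c \<otimes>\<^bsub>R\<^esub> y' = c \<otimes>\<^bsub>R\<^esub> y \<oplus>\<^bsub>R\<^esub> c \<otimes>\<^bsub>R\<^esub> (c \<otimes>\<^bsub>R\<^esub> d \<ominus>\<^bsub>R\<^esub> c \<otimes>\<^bsub>R\<^esub> e)" .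
  moreover have "c \<otimes>\<^bsub>R\<^esub> (y' \<ominus>\<^bsub>R\<^esub> (y \<oplus>\<^bsub>R\<^esub> c \<otimes>\<^bsub>R\<^esub> f)) = c \<otimes>\<^bsub>R\<^esub> y' \<ominus>\<^bsub>R\<^esub> (c \<otimes>\<^bsub>R\<^esub> y \<oplus>\<^bsub>R\<^esub> c \<otimes>\<^bsub>R\<^esub> (c \<otimes>\<^bsub>R\<^esub> f))"
    if "f \<in> carrier R" for f using that c x'(3) y by algebra
  moreover have "c \<otimes>\<^bsub>R\<^esub> d \<ominus>\<^bsub>R\<^esub> c \<otimes>\<^bsub>R\<^esub> e = c \<otimes>\<^bsub>R\<^esub> (d \<ominus>\<^bsub>R\<^esub> e)" using c d(1) e(1) by algebra
  ultimately have "c \<otimes>\<^bsub>R\<^esub> (y' \<ominus>\<^bsub>R\<^esub> (y \<oplus>\<^bsub>R\<^esub> c \<otimes>\<^bsub>R\<^esub> (d \<ominus>\<^bsub>R\<^esub> e))) = \<zero>\<^bsub>R\<^esub>"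
    using c d(1) e(1) y by (simp add: r_neg minus_eq)
  moreover have "y' \<ominus>\<^bsub>R\<^esub> (y \<oplus>\<^bsub>R\<^esub> c \<otimes>\<^bsub>R\<^esub> (d \<ominus>\<^bsub>R\<^esub> e)) \<in> carrier R"
    using c d(1) e(1) y x'(3) by blast
  ultimately have z: "y' \<ominus>\<^bsub>R\<^esub> (y \<oplus>\<^bsub>R\<^esub> c \<otimes>\<^bsub>R\<^esub> (d \<ominus>\<^bsub>R\<^esub> e)) = \<zero>\<^bsub>R\<^esub>"
    using assms(3) unfolding regular_element_def by blast
  have "y \<oplus>\<^bsub>R\<^esub> c \<otimes>\<^bsub>R\<^esub> (d \<ominus>\<^bsub>R\<^esub> e) \<in> carrier R"
    using c d(1) e(1) y by blast
  then have "y' = y \<oplus>\<^bsub>R\<^esub> c \<otimes>\<^bsub>R\<^esub> (d \<ominus>\<^bsub>R\<^esub> e)"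
    using z r_right_minus_eq[OF x'(3)] by blast
  then show "w = spec_proj R c y"
    unfolding w using spec_proj_eq_iff[OF assms(1,2) x'(3) y] minus_closed[OF d(1) e(1)] by blast
qed

end

theory Submission
  imports Defs
begin

text \<open>For tuples \<open>u\<close>, \<open>v\<close> put \<open>G u v = det [tr (u i * v j)]\<close>; this is additive in each entry of \<open>u\<close>
  and of \<open>v\<close>, and \<open>G y y\<close> is the discriminant of \<open>y\<close>. If a derivation \<open>D\<close> commutes with the trace,
  then \<open>D (G y y)\<close> is the sum over \<open>k\<close> of \<open>G y' y + G y y'\<close>, where \<open>y'\<close> is \<open>y\<close> with its \<open>k\<close>-th entry
  replaced by \<open>D (y k)\<close>. By polarization this summand equals \<open>G y'' y'' - G y y - G y' y'\<close>, where
  \<open>y''\<close> is \<open>y\<close> with its \<open>k\<close>-th entry replaced by \<open>y k + D (y k)\<close>. A tuple with a repeated entry has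
  discriminant \<open>0\<close>, so all these terms lie in the discriminant ideal. The ideal is Poisson because
  for \<open>b \<in> C\<close> with lift \<open>b'\<close> the map \<open>a \<mapsto> {a, b}\<close> on \<open>C\<close> is the restriction of the derivation
  \<open>\<sigma> x \<mapsto> \<sigma> ((x b' - b' x) / (q - \<epsilon>))\<close> of the whole specialization.\<close>

section \<open>Finite sums and products\<close>

lemma (in abelian_group) additive_zero:
  assumes h: "h \<in> carrier G \<rightarrow> carrier G"
    and add: "\<And>x y. x \<in> carrier G \<Longrightarrow> y \<in> carrier G \<Longrightarrow> h (x \<oplus> y) = h x \<oplus> h y"
  shows "h \<zero> = \<zero>"
proof -
  have "h \<zero> \<in> carrier G" using h by auto
  moreover from this have "h \<zero> \<oplus> h \<zero> = h \<zero> \<oplus> \<zero>"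
    using add[of \<zero> \<zero>] by simp
  ultimately show ?thesis
    by (simp only: add.l_cancel zero_closed)
qed

lemma (in abelian_group) additive_uminus:
  assumes h: "h \<in> carrier G \<rightarrow> carrier G"
    and add: "\<And>x y. x \<in> carrier G \<Longrightarrow> y \<in> carrier G \<Longrightarrow> h (x \<oplus> y) = h x \<oplus> h y"
    and x: "x \<in> carrier G"
  shows "h (\<ominus> x) = \<ominus> h x"
proof -
  have "h (\<ominus> x) \<oplus> h x = \<zero>"
    using add[of "\<ominus> x" x] additive_zero[OF h add] x by (simp add: l_neg)
  moreover have "h x \<in> carrier G" "h (\<ominus> x) \<in> carrier G"
    using h x by auto
  ultimately show ?thesis by (metis minus_equality)
qed

text \<open>Stated for any map additive on the carrier, so that it serves both for a derivation and
  for the integer multiple by \<open>sign p\<close>.\<close>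

lemma (in abelian_group) additive_finsum:
  assumes "finite A" and "f \<in> A \<rightarrow> carrier G" and h: "h \<in> carrier G \<rightarrow> carrier G"
    and add: "\<And>x y. x \<in> carrier G \<Longrightarrow> y \<in> carrier G \<Longrightarrow> h (x \<oplus> y) = h x \<oplus> h y"
  shows "h (\<Oplus>i\<in>A. f i) = (\<Oplus>i\<in>A. h (f i))"
  using assms(1,2)
proof (induction A)
  case empty
  show ?case by (simp add: additive_zero[OF h add])
next
  case (insert a A)
  have "(\<lambda>i. h (f i)) \<in> A \<rightarrow> carrier G" and "h (f a) \<in> carrier G"
    using insert.prems h by (auto simp: Pi_iff)
  then show ?case
    using insert by (simp add: add finsum_insert finsum_closed)
qed

lemma (in abelian_group) finsum_swap:
  assumes "finite A" "finite B" and f: "\<And>i j. i \<in> A \<Longrightarrow> j \<in> B \<Longrightarrow> f i j \<in> carrier G"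
  shows "(\<Oplus>i\<in>A. \<Oplus>j\<in>B. f i j) = (\<Oplus>j\<in>B. \<Oplus>i\<in>A. f i j)"
  using assms(1) f
proof (induction A)
  case empty
  show ?case by simp
next
  case (insert a A)
  have "(\<Oplus>j\<in>B. \<Oplus>i\<in>insert a A. f i j) = (\<Oplus>j\<in>B. f a j \<oplus> (\<Oplus>i\<in>A. f i j))"
    using insert by (intro finsum_cong') (auto intro!: finsum_insert finsum_closed)
  also have "\<dots> = (\<Oplus>j\<in>B. f a j) \<oplus> (\<Oplus>j\<in>B. \<Oplus>i\<in>A. f i j)"
    using insert by (intro finsum_addf) (auto intro!: finsum_closed)
  finally show ?case
    using insert by (subst finsum_insert) (auto intro!: finsum_closed)
qed

lemma (in comm_monoid) finprod_remove:
  assumes "finite A" "k \<in> A" "f \<in> A \<rightarrow> carrier G"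
  shows "(\<Otimes>i\<in>A. f i) = f k \<otimes> (\<Otimes>i\<in>A - {k}. f i)"
proof -
  have "(\<Otimes>i\<in>insert k (A - {k}). f i) = f k \<otimes> (\<Otimes>i\<in>A - {k}. f i)"
    using assms by (intro finprod_insert) auto
  then show ?thesis
    using assms(2) by (simp add: insert_absorb)
qed

text \<open>Induction on the index set: the product rule splits off the new factor
  \<open>f a\<close>, and distributing \<open>f a\<close> over the sum for \<open>A\<close>
  completes each product that lacks one index of \<open>A\<close>.\<close>

lemma (in cring) leibniz_finprod:
  assumes "finite A" and "f \<in> A \<rightarrow> carrier R" and d: "d \<in> carrier R \<rightarrow> carrier R"
    and mult: "\<And>x y. x \<in> carrier R \<Longrightarrow> y \<in> carrier R \<Longrightarrow> d (x \<otimes> y) = d x \<otimes> y \<oplus> x \<otimes> d y"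
  shows "d (\<Otimes>i\<in>A. f i) = (\<Oplus>k\<in>A. d (f k) \<otimes> (\<Otimes>i\<in>A - {k}. f i))"
  using assms(1,2)
proof (induction A)
  case empty
  \<comment> \<open>The product rule for \<open>\<one> \<otimes> \<one>\<close> gives
    \<open>d \<one> = d \<one> \<oplus> d \<one>\<close>, so the empty product is killed by
    \<open>d\<close>.\<close>
  have "d \<one> \<in> carrier R" using d by auto
  moreover have "d \<one> \<oplus> d \<one> = d \<one> \<oplus> \<zero>"
    using mult[of \<one> \<one>] calculation by simp
  ultimately have "d \<one> = \<zero>"
    by (metis add.l_cancel zero_closed)
  then show ?case by simp
next
  case (insert a A)
  have fc: "f a \<in> carrier R" "\<And>i. i \<in> A \<Longrightarrow> f i \<in> carrier R" and dc: "\<And>x. x \<in> carrier R \<Longrightarrow> d x \<in> carrier R"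
    using insert.prems d by auto
  have pc: "(\<Otimes>i\<in>B. f i) \<in> carrier R" if "B \<subseteq> insert a A" for B
    using insert.prems that by (intro finprod_closed) auto
  have step: "(\<Otimes>i\<in>insert a A - {k}. f i) = f a \<otimes> (\<Otimes>i\<in>A - {k}. f i)" if "k \<in> A" for k
  proof -
    have "insert a A - {k} = insert a (A - {k})" using that insert.hyps by auto
    then show ?thesis
      using insert fc by (simp add: Pi_iff)
  qed
  have "d (\<Otimes>i\<in>insert a A. f i) = d (f a \<otimes> (\<Otimes>i\<in>A. f i))"
    using insert fc by (simp add: Pi_iff)
  also have "\<dots> = d (f a) \<otimes> (\<Otimes>i\<in>A. f i) \<oplus> f a \<otimes> (\<Oplus>k\<in>A. d (f k) \<otimes> (\<Otimes>i\<in>A - {k}. f i))"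
    using insert fc pc[of A] by (subst mult) auto
  also have "f a \<otimes> (\<Oplus>k\<in>A. d (f k) \<otimes> (\<Otimes>i\<in>A - {k}. f i))
      = (\<Oplus>k\<in>A. f a \<otimes> (d (f k) \<otimes> (\<Otimes>i\<in>A - {k}. f i)))"
    using insert.hyps fc dc pc by (intro finsum_rdistr) (auto intro!: m_closed)
  also have "\<dots> = (\<Oplus>k\<in>A. d (f k) \<otimes> (\<Otimes>i\<in>insert a A - {k}. f i))"
  proof (rule finsum_cong')
    fix k assume k: "k \<in> A"
    have "(\<Otimes>i\<in>A - {k}. f i) \<in> carrier R" by (rule pc) auto
    then show "f a \<otimes> (d (f k) \<otimes> (\<Otimes>i\<in>A - {k}. f i)) = d (f k) \<otimes> (\<Otimes>i\<in>insert a A - {k}. f i)"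
      unfolding step[OF k] using fc dc k by (simp add: m_lcomm)
  qed (use fc dc pc in \<open>auto intro!: m_closed\<close>)
  also have "d (f a) \<otimes> (\<Otimes>i\<in>A. f i) = d (f a) \<otimes> (\<Otimes>i\<in>insert a A - {a}. f i)"
    using insert.hyps by simp
  also have "d (f a) \<otimes> (\<Otimes>i\<in>insert a A - {a}. f i) \<oplus> (\<Oplus>k\<in>A. d (f k) \<otimes> (\<Otimes>i\<in>insert a A - {k}. f i))
      = (\<Oplus>k\<in>insert a A. d (f k) \<otimes> (\<Otimes>i\<in>insert a A - {k}. f i))"
    using insert.hyps fc dc pc by (intro finsum_insert[symmetric]) (auto intro!: m_closed)
  finally show ?case .
qed

section \<open>Determinants\<close>

text \<open>The signs in \<open>ring_det\<close> are integers acting on the additive group; the case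
  distinction lets them cancel in pairs and pass through additive maps.\<close>

lemma (in abelian_group) add_pow_sign:
  assumes "x \<in> carrier G"
  shows "[sign p] \<cdot> x = (if evenperm p then x else \<ominus> x)"
  using assms by (simp add: sign_def add.int_pow_neg add.int_pow_1)

context cring
begin

lemma ring_det_closed:
  assumes "\<And>i j. i < n \<Longrightarrow> j < n \<Longrightarrow> A i j \<in> carrier R"
  shows "ring_det R n A \<in> carrier R"
  unfolding ring_det_def
proof (rule finsum_closed, rule Pi_I)
  fix p assume "p \<in> {p. p permutes {..<n}}"
  then have "\<And>i. i < n \<Longrightarrow> p i < n" using permutes_in_image by fastforce
  then show "[sign p] \<cdot> (\<Otimes>i\<in>{..<n}. A i (p i)) \<in> carrier R"
    using assms by (intro add.int_pow_closed finprod_closed) auto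
qed

text \<open>The hypothesis compares permutation products rather than entries, so that it covers a
  sum in a row and a sum in a column alike.\<close>

lemma ring_det_add:
  assumes "\<And>i j. i < n \<Longrightarrow> j < n \<Longrightarrow> B i j \<in> carrier R" "\<And>i j. i < n \<Longrightarrow> j < n \<Longrightarrow> C i j \<in> carrier R"
    and "\<And>p. p permutes {..<n} \<Longrightarrow>
      (\<Otimes>i\<in>{..<n}. A i (p i)) = (\<Otimes>i\<in>{..<n}. B i (p i)) \<oplus> (\<Otimes>i\<in>{..<n}. C i (p i))"
  shows "ring_det R n A = ring_det R n B \<oplus> ring_det R n C"
proof -
  have closed: "(\<Otimes>i\<in>{..<n}. B i (p i)) \<in> carrier R" "(\<Otimes>i\<in>{..<n}. C i (p i)) \<in> carrier R"
    if "p permutes {..<n}" for p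
    using assms(1,2) permutes_in_image[OF that] by (auto intro!: finprod_closed)
  let ?P = "{p. p permutes {..<n}}"
  have "ring_det R n A = (\<Oplus>p\<in>?P. [sign p] \<cdot> (\<Otimes>i\<in>{..<n}. B i (p i)) \<oplus> [sign p] \<cdot> (\<Otimes>i\<in>{..<n}. C i (p i)))"
    unfolding ring_det_def
    using closed by (intro finsum_cong') (simp_all add: assms(3) add.int_pow_distrib Pi_iff)
  also have "\<dots> = ring_det R n B \<oplus> ring_det R n C"
    unfolding ring_det_def using closed by (intro finsum_addf) (simp_all add: Pi_iff)
  finally show ?thesis .
qed

text \<open>Composition with the transposition of \<open>a\<close> and \<open>b\<close> matches even
  permutations with odd ones that have the same product, so the signed terms cancel in pairs. Such a
  pairing also covers characteristic 2.\<close>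

lemma ring_det_identical_rows:
  assumes A: "\<And>i j. i < n \<Longrightarrow> j < n \<Longrightarrow> A i j \<in> carrier R"
    and ab: "a < n" "b < n" "a \<noteq> b" and eq: "\<And>j. j < n \<Longrightarrow> A a j = A b j"
  shows "ring_det R n A = \<zero>"
proof -
  let ?t = "transpose a b"
  let ?P = "{p. p permutes {..<n}}"
  define E where "E = {p \<in> ?P. evenperm p}"
  define f where "f p = (\<Otimes>i\<in>{..<n}. A i (p i))" for p
  have t: "?t permutes {..<n}" using ab by (simp add: permutes_swap_id)
  have perm: "permutation p" if "p \<in> ?P" for p
    using that by (auto simp: permutation_permutes)
  have lt: "p i < n \<longleftrightarrow> i < n" if "p \<in> ?P" for p i
    using permutes_in_image[of p "{..<n}" i] that by simp
  have f_closed: "f p \<in> carrier R" if "p \<in> ?P" for p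
    unfolding f_def using A lt[OF that] by (intro finprod_closed) auto
  have ev: "evenperm (p \<circ> ?t) \<longleftrightarrow> \<not> evenperm p" if "p \<in> ?P" for p
    using ab by (simp add: evenperm_comp[OF perm[OF that] permutation_swap_id] evenperm_swap)
  have tP: "p \<circ> ?t \<in> ?P" if "p \<in> ?P" for p
    using permutes_compose[OF t] that by simp
  \<comment> \<open>Substituting \<open>?t i\<close> for \<open>i\<close> turns the product of
    \<open>p \<circ> ?t\<close> into that of \<open>p\<close> with rows \<open>a\<close> and
    \<open>b\<close> exchanged, and these rows agree.\<close>
  have f_t: "f (p \<circ> ?t) = f p" if p: "p \<in> ?P" for p
  proof -
    have eq': "A (?t i) (p i) = A i (p i)" if "i < n" for i
      using eq[of "p i"] lt[OF p, of i] that by (auto simp: transpose_def)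
    have img: "?t ` {..<n} = {..<n}" by (rule permutes_image[OF t])
    have "(\<Otimes>i\<in>?t ` {..<n}. A i ((p \<circ> ?t) i)) = (\<Otimes>i\<in>{..<n}. A (?t i) ((p \<circ> ?t) (?t i)))"
      using A lt[OF tP[OF p]] unfolding img
      by (subst (1) img[symmetric], intro finprod_reindex) (auto simp: img simp del: o_apply intro: inj_on_subset[OF permutes_inj[OF t]])
    also have "\<dots> = (\<Otimes>i\<in>{..<n}. A i (p i))"
      using A lt[OF p] eq' by (intro finprod_cong') auto
    finally show ?thesis unfolding f_def img .
  qed
  \<comment> \<open>Since \<open>?t\<close> is an involution, every odd permutation is an even one
    composed with \<open>?t\<close>.\<close>
  have P_split: "?P = E \<union> (\<lambda>p. p \<circ> ?t) ` E"
  proof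
    show "?P \<subseteq> E \<union> (\<lambda>p. p \<circ> ?t) ` E"
    proof
      fix p assume p: "p \<in> ?P"
      show "p \<in> E \<union> (\<lambda>p. p \<circ> ?t) ` E"
      proof (cases "evenperm p")
        case False
        then have "p \<circ> ?t \<in> E" using ev[OF p] tP[OF p] by (simp add: E_def)
        moreover have "p = (p \<circ> ?t) \<circ> ?t" by (simp add: comp_assoc)
        ultimately show ?thesis by blast
      qed (use p in \<open>simp add: E_def\<close>)
    qed
  qed (use tP in \<open>auto simp: E_def\<close>)
  have fin: "finite E" unfolding E_def by (simp add: finite_permutations)
  have inj: "inj_on (\<lambda>p. p \<circ> ?t) E"
    by (rule inj_on_inverseI[where g = "\<lambda>p. p \<circ> ?t"]) (simp add: comp_assoc)
  define g where "g p = (if evenperm p then f p else \<ominus> f p)" for p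
  have g_closed: "g p \<in> carrier R" if "p \<in> ?P" for p
    using f_closed[OF that] by (simp add: g_def)
  have E_P: "p \<in> ?P" "p \<circ> ?t \<in> ?P" if "p \<in> E" for p
    using that tP by (auto simp: E_def)
  have "ring_det R n A = (\<Oplus>p\<in>?P. g p)"
    unfolding ring_det_def f_def[symmetric]
    using g_closed f_closed by (intro finsum_cong') (auto simp: g_def add_pow_sign)
  also have "\<dots> = (\<Oplus>p\<in>E. g p) \<oplus> (\<Oplus>p\<in>(\<lambda>p. p \<circ> ?t) ` E. g p)"
    unfolding P_split
    using fin E_P ev by (intro finsum_Un_disjoint) (auto simp: E_def intro!: g_closed tP)
  also have "(\<Oplus>p\<in>(\<lambda>p. p \<circ> ?t) ` E. g p) = (\<Oplus>p\<in>E. g (p \<circ> ?t))"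
    using inj E_P(2) by (intro finsum_reindex) (auto intro!: g_closed)
  also have "(\<Oplus>p\<in>E. g p) \<oplus> (\<Oplus>p\<in>E. g (p \<circ> ?t)) = (\<Oplus>p\<in>E. g p \<oplus> g (p \<circ> ?t))"
    using E_P by (intro finsum_addf[symmetric]) (auto intro!: g_closed)
  also have "\<dots> = (\<Oplus>p\<in>E. \<zero>)"
  proof (rule finsum_cong')
    fix p assume p: "p \<in> E"
    then show "g p \<oplus> g (p \<circ> ?t) = \<zero>"
      using ev[OF E_P(1)[OF p]] f_t[OF E_P(1)[OF p]] f_closed[OF E_P(1)[OF p]]
      by (simp add: g_def E_def r_neg)
  qed auto
  finally show ?thesis by simp
qed

end

section \<open>Gram determinants\<close>

text \<open>Later \<open>V\<close> is the carrier of the possibly noncommutative specialization,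
  \<open>R\<close> its central subalgebra \<open>C\<close>, and \<open>\<beta>\<close> the trace
  form. Vectors and matrix entries live in separate sets, so that determinants are taken over a
  commutative ring.\<close>

locale biadditive_form = cring R for R :: "('a, 'm) ring_scheme" (structure) +
  fixes V :: "'b set" and plus :: "'b \<Rightarrow> 'b \<Rightarrow> 'b" and \<beta> :: "'b \<Rightarrow> 'b \<Rightarrow> 'a"
  assumes plus_closed: "x \<in> V \<Longrightarrow> y \<in> V \<Longrightarrow> plus x y \<in> V"
    and form_closed: "x \<in> V \<Longrightarrow> y \<in> V \<Longrightarrow> \<beta> x y \<in> carrier R"
    and form_plus_left: "x \<in> V \<Longrightarrow> y \<in> V \<Longrightarrow> z \<in> V \<Longrightarrow> \<beta> (plus x y) z = \<beta> x z \<oplus> \<beta> y z"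
    and form_plus_right: "x \<in> V \<Longrightarrow> y \<in> V \<Longrightarrow> z \<in> V \<Longrightarrow> \<beta> z (plus x y) = \<beta> z x \<oplus> \<beta> z y"
begin

text \<open>Two tuples are allowed because differentiating a matrix entry changes its row vector or
  its column vector, one at a time.\<close>

definition gram_det :: "nat \<Rightarrow> (nat \<Rightarrow> 'b) \<Rightarrow> (nat \<Rightarrow> 'b) \<Rightarrow> 'a" where
  "gram_det n u v = ring_det R n (\<lambda>i j. \<beta> (u i) (v j))"

lemma gram_det_closed:
  assumes "u \<in> {..<n} \<rightarrow> V" "v \<in> {..<n} \<rightarrow> V"
  shows "gram_det n u v \<in> carrier R"
  unfolding gram_det_def using assms by (intro ring_det_closed form_closed) auto

text \<open>Only the factor of row \<open>k\<close> involves the entry \<open>u k\<close>; isolating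
  it reduces additivity of the determinant to that of the form.\<close>

lemma prod_update_left:
  fixes n :: nat
  assumes "u \<in> {..<n} \<rightarrow> V" "v \<in> {..<n} \<rightarrow> V" "x \<in> V" "k < n" "p permutes {..<n}"
  shows "(\<Otimes>i\<in>{..<n}. \<beta> ((u(k := x)) i) (v (p i)))
    = \<beta> x (v (p k)) \<otimes> (\<Otimes>i\<in>{..<n} - {k}. \<beta> (u i) (v (p i)))"
proof -
  have p: "p i < n" if "i < n" for i
    using permutes_in_image[OF assms(5), of i] that by simp
  have "(\<Otimes>i\<in>{..<n}. \<beta> ((u(k := x)) i) (v (p i))) = \<beta> ((u(k := x)) k) (v (p k)) \<otimes>
     (\<Otimes>i\<in>{..<n} - {k}. \<beta> ((u(k := x)) i) (v (p i)))"
    using assms p by (intro finprod_remove) (auto intro!: form_closed)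
  moreover have "(\<Otimes>i\<in>{..<n} - {k}. \<beta> ((u(k := x)) i) (v (p i))) = (\<Otimes>i\<in>{..<n} - {k}. \<beta> (u i) (v (p i)))"
    using assms p by (intro finprod_cong') (auto intro!: form_closed)
  ultimately show ?thesis by simp
qed

text \<open>The updated position is \<open>p k\<close> because row \<open>k\<close> meets the column
  vector \<open>v (p k)\<close>. As \<open>p\<close> is injective, no other factor changes, and the
  remaining product is the same as in \<open>prod_update_left\<close>.\<close>

lemma prod_update_right:
  fixes n :: nat
  assumes "u \<in> {..<n} \<rightarrow> V" "v \<in> {..<n} \<rightarrow> V" "x \<in> V" "k < n" "p permutes {..<n}"
  shows "(\<Otimes>i\<in>{..<n}. \<beta> (u i) ((v(p k := x)) (p i)))
    = \<beta> (u k) x \<otimes> (\<Otimes>i\<in>{..<n} - {k}. \<beta> (u i) (v (p i)))"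
proof -
  have p: "p i < n" if "i < n" for i
    using permutes_in_image[OF assms(5), of i] that by simp
  have inj: "p i = p j \<longleftrightarrow> i = j" for i j
    using permutes_inj[OF assms(5)] by (simp add: inj_eq)
  have "(\<Otimes>i\<in>{..<n}. \<beta> (u i) ((v(p k := x)) (p i))) = \<beta> (u k) ((v(p k := x)) (p k)) \<otimes>
     (\<Otimes>i\<in>{..<n} - {k}. \<beta> (u i) ((v(p k := x)) (p i)))"
    using assms p by (intro finprod_remove) (auto intro!: form_closed)
  moreover have "(\<Otimes>i\<in>{..<n} - {k}. \<beta> (u i) ((v(p k := x)) (p i))) = (\<Otimes>i\<in>{..<n} - {k}. \<beta> (u i) (v (p i)))"
    using assms p by (intro finprod_cong') (auto simp: inj intro!: form_closed)
  ultimately show ?thesis by simp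
qed

lemma prod_closed:
  fixes n :: nat
  assumes "u \<in> {..<n} \<rightarrow> V" "v \<in> {..<n} \<rightarrow> V" "p permutes {..<n}" "B \<subseteq> {..<n}"
  shows "(\<Otimes>i\<in>B. \<beta> (u i) (v (p i))) \<in> carrier R"
proof -
  have p: "p i < n" if "i < n" for i
    using permutes_in_image[OF assms(3), of i] that by simp
  show ?thesis
    using assms p by (intro finprod_closed Pi_I form_closed) (auto simp: Pi_iff subset_iff)
qed

lemma gram_det_plus_left:
  assumes uv: "u \<in> {..<n} \<rightarrow> V" "v \<in> {..<n} \<rightarrow> V" and x: "x \<in> V" "y \<in> V" and k: "k < n"
  shows "gram_det n (u(k := plus x y)) v = gram_det n (u(k := x)) v \<oplus> gram_det n (u(k := y)) v"
  unfolding gram_det_def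
proof (rule ring_det_add)
  fix p assume p: "p permutes {..<n}"
  have "p k < n" using permutes_in_image[OF p, of k] k by simp
  then have "v (p k) \<in> V" using uv by auto
  then show "(\<Otimes>i\<in>{..<n}. \<beta> ((u(k := plus x y)) i) (v (p i)))
    = (\<Otimes>i\<in>{..<n}. \<beta> ((u(k := x)) i) (v (p i))) \<oplus> (\<Otimes>i\<in>{..<n}. \<beta> ((u(k := y)) i) (v (p i)))"
    unfolding prod_update_left[OF uv x(1) k p] prod_update_left[OF uv x(2) k p]
      prod_update_left[OF uv plus_closed[OF x] k p]
    using x prod_closed[OF uv p, of "{..<n} - {k}"]
    by (simp add: form_plus_left form_closed l_distr)
qed (use assms in \<open>auto intro!: form_closed\<close>)

lemma gram_det_plus_right:
  assumes uv: "u \<in> {..<n} \<rightarrow> V" "v \<in> {..<n} \<rightarrow> V" and x: "x \<in> V" "y \<in> V" and k: "k < n"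
  shows "gram_det n u (v(k := plus x y)) = gram_det n u (v(k := x)) \<oplus> gram_det n u (v(k := y))"
  unfolding gram_det_def
proof (rule ring_det_add)
  fix p assume p: "p permutes {..<n}"
  \<comment> \<open>Column \<open>k\<close> enters the product of \<open>p\<close> in the row that
    \<open>p\<close> sends to \<open>k\<close>.\<close>
  obtain l where l: "l < n" "k = p l"
    using permutes_image[OF p] k by (metis imageE lessThan_iff)
  then have "u l \<in> V" using uv by auto
  then show "(\<Otimes>i\<in>{..<n}. \<beta> (u i) ((v(k := plus x y)) (p i)))
    = (\<Otimes>i\<in>{..<n}. \<beta> (u i) ((v(k := x)) (p i))) \<oplus> (\<Otimes>i\<in>{..<n}. \<beta> (u i) ((v(k := y)) (p i)))"
    unfolding l(2) prod_update_right[OF uv x(1) l(1) p] prod_update_right[OF uv x(2) l(1) p]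
      prod_update_right[OF uv plus_closed[OF x] l(1) p]
    using x prod_closed[OF uv p, of "{..<n} - {l}"]
    by (simp add: form_plus_right form_closed l_distr)
qed (use assms in \<open>auto intro!: form_closed\<close>)

text \<open>Expanding the determinant at \<open>plus (y k) x\<close> in both tuples gives two
  diagonal and two mixed terms. No division by 2 occurs, so the sum of the mixed terms is a
  combination of diagonal ones in every characteristic.\<close>

lemma gram_det_polarization:
  assumes y: "y \<in> {..<n} \<rightarrow> V" and x: "x \<in> V" and k: "k < n"
  shows "gram_det n (y(k := x)) y \<oplus> gram_det n y (y(k := x))
    = gram_det n (y(k := plus (y k) x)) (y(k := plus (y k) x))
      \<ominus> (gram_det n y y \<oplus> gram_det n (y(k := x)) (y(k := x)))"
proof -
  have yk: "y k \<in> V" using y k by auto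
  have upd: "y(k := z) \<in> {..<n} \<rightarrow> V" if "z \<in> V" for z using y that by auto
  let ?a = "gram_det n y y" and ?b = "gram_det n (y(k := x)) y"
    and ?c = "gram_det n y (y(k := x))" and ?d = "gram_det n (y(k := x)) (y(k := x))"
  \<comment> \<open>The left tuple is expanded first, then the right one in each resulting term;
    replacing entry \<open>k\<close> by \<open>y k\<close> gives back \<open>y\<close>.\<close>
  have expand: "gram_det n (y(k := plus (y k) x)) (y(k := plus (y k) x)) = (?a \<oplus> ?c) \<oplus> (?b \<oplus> ?d)"
    using gram_det_plus_left[OF y upd[OF plus_closed[OF yk x]] yk x k]
      gram_det_plus_right[OF y y yk x k] gram_det_plus_right[OF upd[OF x] y yk x k]
    by simp
  have abcd: "?a \<in> carrier R" "?b \<in> carrier R" "?c \<in> carrier R" "?d \<in> carrier R"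
    using y upd[OF x] by (auto intro!: gram_det_closed simp del: fun_upd_apply)
  have "b \<oplus> c = ((a \<oplus> c) \<oplus> (b \<oplus> d)) \<ominus> (a \<oplus> d)"
    if "a \<in> carrier R" "b \<in> carrier R" "c \<in> carrier R" "d \<in> carrier R" for a b c d
    using that by algebra
  from this[OF abcd] show ?thesis unfolding expand .
qed

text \<open>Replacing an entry may create a repetition, and then the tuple no longer enumerates an
  \<open>n\<close>-element subset. Two equal entries give two equal rows.\<close>

lemma gram_det_not_inj:
  assumes y: "y \<in> {..<n} \<rightarrow> V" and "\<not> inj_on y {..<n}"
  shows "gram_det n y y = \<zero>"
proof -
  obtain a b where "a < n" "b < n" "a \<noteq> b" "y a = y b"
    using assms(2) by (auto simp: inj_on_def)
  then show ?thesis
    unfolding gram_det_def using y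
    by (intro ring_det_identical_rows[where a = a and b = b]) (auto intro!: form_closed)
qed

text \<open>Differentiating the factor \<open>\<beta> (y k) (y (p k))\<close> of a permutation
  product replaces either the row vector \<open>k\<close> or the column vector \<open>p k\<close>.
  Regrouping by the index of the replaced vector, and interchanging that sum with the sum over
  permutations, reassembles determinants.\<close>

lemma derivation_gram_det:
  assumes d: "d \<in> carrier R \<rightarrow> carrier R"
    and d_add: "\<And>x y. x \<in> carrier R \<Longrightarrow> y \<in> carrier R \<Longrightarrow> d (x \<oplus> y) = d x \<oplus> d y"
    and d_mult: "\<And>x y. x \<in> carrier R \<Longrightarrow> y \<in> carrier R \<Longrightarrow> d (x \<otimes> y) = d x \<otimes> y \<oplus> x \<otimes> d y"
    and D: "D \<in> V \<rightarrow> V"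
    and d_form: "\<And>x y. x \<in> V \<Longrightarrow> y \<in> V \<Longrightarrow> d (\<beta> x y) = \<beta> (D x) y \<oplus> \<beta> x (D y)"
    and y: "y \<in> {..<n} \<rightarrow> V"
  shows "d (gram_det n y y)
    = (\<Oplus>k\<in>{..<n}. gram_det n (y(k := D (y k))) y \<oplus> gram_det n y (y(k := D (y k))))"
proof -
  let ?P = "{p. p permutes {..<n}}"
  let ?m = "\<lambda>u v p. \<Otimes>i\<in>{..<n}. \<beta> (u i) (v (p i))"
  define w where "w k = y(k := D (y k))" for k
  have w: "w k \<in> {..<n} \<rightarrow> V" if "k < n" for k
    using y D that by (auto simp: w_def Pi_iff)
  have m_closed': "?m u v p \<in> carrier R" if "u \<in> {..<n} \<rightarrow> V" "v \<in> {..<n} \<rightarrow> V" "p \<in> ?P" for u v p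
    using prod_closed[of u n v p "{..<n}"] that by simp
  have finP: "finite ?P" by (simp add: finite_permutations)
  have prod: "d (?m y y p) = (\<Oplus>k\<in>{..<n}. ?m (w k) y p \<oplus> ?m y (w k) p)" if p: "p \<in> ?P" for p
  proof -
    have perm: "p permutes {..<n}" using p by simp
    have lt: "p i < n" if "i < n" for i
      using permutes_in_image[OF perm, of i] that by simp
    have yX: "y i \<in> V" "D (y i) \<in> V" if "i < n" for i using y D that by auto
    have "d (?m y y p) = (\<Oplus>k\<in>{..<n}. d (\<beta> (y k) (y (p k))) \<otimes> (\<Otimes>i\<in>{..<n} - {k}. \<beta> (y i) (y (p i))))"
      using yX lt by (intro leibniz_finprod d d_mult) (auto intro!: form_closed)
    also have "\<dots> = (\<Oplus>k\<in>{..<n}. ?m (w k) y p \<oplus> ?m y (w (p k)) p)"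
    proof (rule finsum_cong')
      fix k assume "k \<in> {..<n}"
      then have k: "k < n" by simp
      show "d (\<beta> (y k) (y (p k))) \<otimes> (\<Otimes>i\<in>{..<n} - {k}. \<beta> (y i) (y (p i)))
        = ?m (w k) y p \<oplus> ?m y (w (p k)) p"
        unfolding w_def prod_update_left[OF y y yX(2)[OF k] k perm]
          prod_update_right[OF y y yX(2)[OF lt[OF k]] k perm]
        using prod_closed[OF y y perm, of "{..<n} - {k}"] yX k lt[OF k]
        by (simp add: d_form form_closed l_distr)
    qed (use y w lt p in \<open>auto intro!: a_closed m_closed'\<close>)
    also have "\<dots> = (\<Oplus>k\<in>{..<n}. ?m (w k) y p) \<oplus> (\<Oplus>k\<in>{..<n}. ?m y (w (p k)) p)"
      using y w lt p by (intro finsum_addf) (auto intro!: m_closed')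
    \<comment> \<open>The column changes are so far indexed by their row. As \<open>p\<close>
      permutes the indices, they can be indexed by the column itself, which matches the row
      changes.\<close>
    also have "(\<Oplus>k\<in>{..<n}. ?m y (w (p k)) p) = (\<Oplus>k\<in>p ` {..<n}. ?m y (w k) p)"
      using y w lt p permutes_inj[OF perm]
      by (intro finsum_reindex[symmetric]) (auto intro!: m_closed' intro: inj_on_subset)
    also have "(\<Oplus>k\<in>{..<n}. ?m (w k) y p) \<oplus> (\<Oplus>k\<in>p ` {..<n}. ?m y (w k) p)
        = (\<Oplus>k\<in>{..<n}. ?m (w k) y p \<oplus> ?m y (w k) p)"
      unfolding permutes_image[OF perm]
      using y w p by (intro finsum_addf[symmetric]) (auto intro!: m_closed')
    finally show ?thesis .
  qed
  have sgn_add: "[sign p] \<cdot> (\<Oplus>k\<in>{..<n}. ?m (w k) y p \<oplus> ?m y (w k) p)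
      = (\<Oplus>k\<in>{..<n}. [sign p] \<cdot> ?m (w k) y p \<oplus> [sign p] \<cdot> ?m y (w k) p)" if p: "p \<in> ?P" for p
  proof -
    have "[sign p] \<cdot> (\<Oplus>k\<in>{..<n}. ?m (w k) y p \<oplus> ?m y (w k) p)
      = (\<Oplus>k\<in>{..<n}. [sign p] \<cdot> (?m (w k) y p \<oplus> ?m y (w k) p))"
      using y w p
      by (intro additive_finsum) (auto intro!: a_closed m_closed' add.int_pow_distrib)
    also have "\<dots> = (\<Oplus>k\<in>{..<n}. [sign p] \<cdot> ?m (w k) y p \<oplus> [sign p] \<cdot> ?m y (w k) p)"
      using y w p
      by (intro finsum_cong') (auto intro!: a_closed m_closed' add.int_pow_distrib add.int_pow_closed)
    finally show ?thesis .
  qed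
  \<comment> \<open>An additive map preserves negatives, hence commutes with signs.\<close>
  have d_sign: "d ([sign p] \<cdot> x) = [sign p] \<cdot> d x" if x: "x \<in> carrier R" for p :: "nat \<Rightarrow> nat" and x
  proof -
    have "d x \<in> carrier R" using d x by auto
    then show ?thesis
      using x additive_uminus[OF d d_add x] by (simp add: add_pow_sign)
  qed
  have "d (gram_det n y y) = (\<Oplus>p\<in>?P. d ([sign p] \<cdot> ?m y y p))"
    unfolding gram_det_def ring_det_def
    using y finP by (intro additive_finsum d d_add) (auto intro!: m_closed' add.int_pow_closed)
  also have "\<dots> = (\<Oplus>p\<in>?P. \<Oplus>k\<in>{..<n}. [sign p] \<cdot> ?m (w k) y p \<oplus> [sign p] \<cdot> ?m y (w k) p)"
  proof (rule finsum_cong')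
    fix p assume p: "p \<in> ?P"
    show "d ([sign p] \<cdot> ?m y y p) = (\<Oplus>k\<in>{..<n}. [sign p] \<cdot> ?m (w k) y p \<oplus> [sign p] \<cdot> ?m y (w k) p)"
      by (simp only: d_sign[OF m_closed'[OF y y p]] prod[OF p] sgn_add[OF p])
  qed (use y w in \<open>auto intro!: finsum_closed a_closed m_closed' add.int_pow_closed\<close>)
  \<comment> \<open>After the interchange each inner sum is the joint Leibniz expansion of two Gram
    determinants.\<close>
  also have "\<dots> = (\<Oplus>k\<in>{..<n}. \<Oplus>p\<in>?P. [sign p] \<cdot> ?m (w k) y p \<oplus> [sign p] \<cdot> ?m y (w k) p)"
    using y w finP by (intro finsum_swap) (auto intro!: a_closed m_closed' add.int_pow_closed)
  also have "\<dots> = (\<Oplus>k\<in>{..<n}. gram_det n (w k) y \<oplus> gram_det n y (w k))"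
  proof (rule finsum_cong')
    fix k assume k: "k \<in> {..<n}"
    show "(\<Oplus>p\<in>?P. [sign p] \<cdot> ?m (w k) y p \<oplus> [sign p] \<cdot> ?m y (w k) p)
      = gram_det n (w k) y \<oplus> gram_det n y (w k)"
      unfolding gram_det_def ring_det_def
      using y w[of k] k by (intro finsum_addf) (auto intro!: m_closed' add.int_pow_closed)
  qed (use y w in \<open>auto intro!: gram_det_closed\<close>)
  finally show ?thesis unfolding w_def .
qed

end

section \<open>Ideals stable under a derivation\<close>

lemma (in ideal) finsum_in_ideal:
  assumes "finite A" "f \<in> A \<rightarrow> I"
  shows "(\<Oplus>i\<in>A. f i) \<in> I"
  using assms
proof (induction A)
  case empty
  show ?case by simp
next
  case (insert a A)
  then have "f \<in> A \<rightarrow> carrier R" "f a \<in> carrier R"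
    using a_subset by auto
  then show ?case
    using insert by (simp add: finsum_insert)
qed

text \<open>The elements of \<open>Idl H\<close> whose derivative stays in \<open>Idl H\<close> form
  an ideal containing \<open>H\<close>; minimality of \<open>Idl H\<close> then finishes.\<close>

lemma (in cring) derivation_genideal:
  assumes H: "H \<subseteq> carrier R" and d: "d \<in> carrier R \<rightarrow> carrier R"
    and d_add: "\<And>x y. x \<in> carrier R \<Longrightarrow> y \<in> carrier R \<Longrightarrow> d (x \<oplus> y) = d x \<oplus> d y"
    and d_mult: "\<And>x y. x \<in> carrier R \<Longrightarrow> y \<in> carrier R \<Longrightarrow> d (x \<otimes> y) = d x \<otimes> y \<oplus> x \<otimes> d y"
    and gen: "\<And>h. h \<in> H \<Longrightarrow> d h \<in> Idl H" and x: "x \<in> Idl H"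
  shows "d x \<in> Idl H"
proof -
  interpret I: ideal "Idl H" R by (rule genideal_ideal[OF H])
  have carr: "z \<in> carrier R" if "z \<in> Idl H" for z using that I.a_subset by auto
  \<comment> \<open>Membership in \<open>Idl H\<close> is built into \<open>J\<close>: in
    \<open>d z \<otimes> a \<oplus> z \<otimes> d a\<close> the first term lies in
    \<open>Idl H\<close> because \<open>a\<close> does.\<close>
  define J where "J = {z \<in> Idl H. d z \<in> Idl H}"
  have "ideal J R"
  proof (rule idealI)
    show "ring R" by (rule ring_axioms)
    show "subgroup J (add_monoid R)"
    proof (rule add.subgroupI)
      show "J \<subseteq> carrier R" using carr by (auto simp: J_def)
      have "\<zero> \<in> J"
        using additive_zero[OF d d_add] additive_subgroup.zero_closed[OF I.additive_subgroup_axioms]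
        by (simp add: J_def)
      then show "J \<noteq> {}" by blast
      show "\<ominus> a \<in> J" if "a \<in> J" for a
        using that carr additive_uminus[OF d d_add] by (auto simp: J_def)
      show "a \<oplus> b \<in> J" if "a \<in> J" "b \<in> J" for a b
        using that carr by (auto simp: J_def d_add)
    qed
  next
    fix a z assume a: "a \<in> J" and z: "z \<in> carrier R"
    have "d z \<in> carrier R" using d z by auto
    then have "z \<otimes> a \<in> J"
      using a z carr I.I_l_closed by (auto simp: J_def d_mult)
    moreover have "a \<otimes> z = z \<otimes> a"
      using a z carr by (auto simp: J_def m_comm)
    ultimately show "z \<otimes> a \<in> J" "a \<otimes> z \<in> J" by auto
  qed
  moreover have "H \<subseteq> J"
    using gen genideal_self[OF H] by (auto simp: J_def)
  ultimately have "Idl H \<subseteq> J" by (rule genideal_minimal)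
  then show ?thesis using x by (auto simp: J_def)
qed

section \<open>Derivations and discriminant ideals\<close>

lemma cring_of_central_subring:
  assumes "ring S" "subring C S" "C \<subseteq> ring_center S"
  shows "cring (S\<lparr>carrier := C\<rparr>)"
proof -
  interpret ring "S\<lparr>carrier := C\<rparr>"
    using ring.subring_is_ring[OF assms(1,2)] .
  show ?thesis
    using assms(3) by unfold_locales (auto simp: ring_center_def)
qed

text \<open>Biadditivity comes from distributivity in \<open>S\<close> and additivity of the trace.
  Through this instance the results on Gram determinants apply to discriminants.\<close>

lemma trace_form:
  assumes "ring S" "subring C S" "C \<subseteq> ring_center S" and tr: "trace_function S C tr"
  shows "biadditive_form (S\<lparr>carrier := C\<rparr>) (carrier S) (\<lambda>x y. x \<oplus>\<^bsub>S\<^esub> y) (\<lambda>x y. tr (x \<otimes>\<^bsub>S\<^esub> y))"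
proof -
  interpret S: ring S by fact
  interpret C: cring "S\<lparr>carrier := C\<rparr>" by (rule cring_of_central_subring) fact+
  have tr_closed: "tr x \<in> C" and tr_add: "tr (x \<oplus>\<^bsub>S\<^esub> y) = tr x \<oplus>\<^bsub>S\<^esub> tr y"
    if "x \<in> carrier S" "y \<in> carrier S" for x y
    using tr that by (auto simp: trace_function_def)
  show ?thesis
    by unfold_locales (auto simp: S.l_distr S.r_distr tr_add intro: tr_closed)
qed

text \<open>The second claim is the condition under which \<open>Idl\<close> of the generators is an
  ideal of \<open>C\<close> containing them.\<close>

lemma discriminant_ideal_is_ideal:
  assumes "ring S" "subring C S" "C \<subseteq> ring_center S" "trace_function S C tr"
  shows "ideal (discriminant_ideal S C tr n) (S\<lparr>carrier := C\<rparr>)"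
    and "{discriminant S C tr n y | y. y ` {..<n} \<subseteq> carrier S \<and> inj_on y {..<n}} \<subseteq> C"
proof -
  interpret F: biadditive_form "S\<lparr>carrier := C\<rparr>" "carrier S" "\<lambda>x y. x \<oplus>\<^bsub>S\<^esub> y" "\<lambda>x y. tr (x \<otimes>\<^bsub>S\<^esub> y)"
    using assms by (rule trace_form)
  have "discriminant S C tr n y \<in> C" if "y ` {..<n} \<subseteq> carrier S" for y
  proof -
    have "y \<in> {..<n} \<rightarrow> carrier S" using that by auto
    from F.gram_det_closed[OF this this] show ?thesis
      by (simp add: discriminant_def F.gram_det_def)
  qed
  then show *: "{discriminant S C tr n y | y. y ` {..<n} \<subseteq> carrier S \<and> inj_on y {..<n}} \<subseteq> C"
    by auto
  show "ideal (discriminant_ideal S C tr n) (S\<lparr>carrier := C\<rparr>)"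
    unfolding discriminant_ideal_def using * by (intro F.genideal_ideal) simp
qed

lemma discriminant_ideal_derivation:
  assumes "ring S" "subring C S" "C \<subseteq> ring_center S" and tr: "trace_function S C tr"
    and D: "derivation K S \<iota> D" "D ` C \<subseteq> C" "commutes_with_trace S tr D"
    and a: "a \<in> discriminant_ideal S C tr n"
  shows "D a \<in> discriminant_ideal S C tr n"
proof -
  interpret S: ring S by fact
  interpret F: biadditive_form "S\<lparr>carrier := C\<rparr>" "carrier S" "\<lambda>x y. x \<oplus>\<^bsub>S\<^esub> y" "\<lambda>x y. tr (x \<otimes>\<^bsub>S\<^esub> y)"
    using assms(1-4) by (rule trace_form)
  let ?C = "S\<lparr>carrier := C\<rparr>" and ?I = "discriminant_ideal S C tr n"
  let ?H = "{discriminant S C tr n y | y. y ` {..<n} \<subseteq> carrier S \<and> inj_on y {..<n}}"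
  interpret I: ideal ?I ?C using assms(1-4) by (rule discriminant_ideal_is_ideal)
  have C_sub: "C \<subseteq> carrier S" using assms(3) by (auto simp: ring_center_def)
  have H: "?H \<subseteq> carrier ?C" using discriminant_ideal_is_ideal(2)[OF assms(1-4)] by simp
  have Dc: "D \<in> carrier S \<rightarrow> carrier S"
    and D_add: "\<And>x y. x \<in> carrier S \<Longrightarrow> y \<in> carrier S \<Longrightarrow> D (x \<oplus>\<^bsub>S\<^esub> y) = D x \<oplus>\<^bsub>S\<^esub> D y"
    and D_mult: "\<And>x y. x \<in> carrier S \<Longrightarrow> y \<in> carrier S \<Longrightarrow> D (x \<otimes>\<^bsub>S\<^esub> y) = D x \<otimes>\<^bsub>S\<^esub> y \<oplus>\<^bsub>S\<^esub> x \<otimes>\<^bsub>S\<^esub> D y"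
    using D(1) by (auto simp: derivation_def)
  have tr_add: "tr (x \<oplus>\<^bsub>S\<^esub> y) = tr x \<oplus>\<^bsub>S\<^esub> tr y" if "x \<in> carrier S" "y \<in> carrier S" for x y
    using tr that by (auto simp: trace_function_def)
  have d: "D \<in> carrier ?C \<rightarrow> carrier ?C" using D(2) by auto
  have d_add: "D (x \<oplus>\<^bsub>?C\<^esub> y) = D x \<oplus>\<^bsub>?C\<^esub> D y"
    and d_mult: "D (x \<otimes>\<^bsub>?C\<^esub> y) = D x \<otimes>\<^bsub>?C\<^esub> y \<oplus>\<^bsub>?C\<^esub> x \<otimes>\<^bsub>?C\<^esub> D y"
    if "x \<in> carrier ?C" "y \<in> carrier ?C" for x y
    using that C_sub by (auto simp: D_add D_mult subset_iff)
  \<comment> \<open>Since the trace commutes with \<open>D\<close>, the product rule in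
    \<open>S\<close> passes to the trace form.\<close>
  have d_form: "D (tr (x \<otimes>\<^bsub>S\<^esub> y)) = tr (D x \<otimes>\<^bsub>S\<^esub> y) \<oplus>\<^bsub>?C\<^esub> tr (x \<otimes>\<^bsub>S\<^esub> D y)"
    if "x \<in> carrier S" "y \<in> carrier S" for x y
  proof -
    have xy: "D x \<in> carrier S" "D y \<in> carrier S" using that Dc by auto
    have "D (tr (x \<otimes>\<^bsub>S\<^esub> y)) = tr (D (x \<otimes>\<^bsub>S\<^esub> y))"
      using D(3) that by (simp add: commutes_with_trace_def)
    then show ?thesis using that xy by (simp add: D_mult tr_add)
  qed
  have gram_in: "F.gram_det n y y \<in> ?I" if y: "y \<in> {..<n} \<rightarrow> carrier S" for y
  proof (cases "inj_on y {..<n}")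
    case True
    then have "F.gram_det n y y \<in> ?H"
      using y unfolding F.gram_det_def discriminant_def[symmetric] by blast
    then show ?thesis
      unfolding discriminant_ideal_def using F.genideal_self[OF H] by blast
  next
    case False
    then show ?thesis using F.gram_det_not_inj[OF y] additive_subgroup.zero_closed[OF I.additive_subgroup_axioms] by simp
  qed
  have gen: "D h \<in> ?I" if h_in: "h \<in> ?H" for h
  proof -
    obtain y where "y ` {..<n} \<subseteq> carrier S" and "h = discriminant S C tr n y"
      using h_in by auto
    then have y: "y \<in> {..<n} \<rightarrow> carrier S" and h: "h = F.gram_det n y y"
      by (auto simp: discriminant_def F.gram_det_def)
    have "F.gram_det n (y(k := D (y k))) y \<oplus>\<^bsub>?C\<^esub> F.gram_det n y (y(k := D (y k))) \<in> ?I"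
      if k: "k < n" for k
    proof -
      have yk: "y k \<in> carrier S" "D (y k) \<in> carrier S" using y Dc k by auto
      have upd: "y(k := x) \<in> {..<n} \<rightarrow> carrier S" if "x \<in> carrier S" for x
        using y that by (auto simp: Pi_iff)
      \<comment> \<open>After polarization only diagonal Gram determinants remain, each covered by
        \<open>gram_in\<close>.\<close>
      show ?thesis
        unfolding F.gram_det_polarization[OF y yk(2) k] a_minus_def
        using y upd yk by (intro additive_subgroup.a_closed[OF I.additive_subgroup_axioms]
            additive_subgroup.a_inv_closed[OF I.additive_subgroup_axioms] gram_in) (auto simp del: fun_upd_apply)
    qed
    then have "(\<Oplus>\<^bsub>?C\<^esub>k\<in>{..<n}. F.gram_det n (y(k := D (y k))) y \<oplus>\<^bsub>?C\<^esub> F.gram_det n y (y(k := D (y k)))) \<in> ?I"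
      by (intro I.finsum_in_ideal) (simp_all only: finite_lessThan Pi_iff lessThan_iff, simp)
    moreover have "D (F.gram_det n y y)
      = (\<Oplus>\<^bsub>?C\<^esub>k\<in>{..<n}. F.gram_det n (y(k := D (y k))) y \<oplus>\<^bsub>?C\<^esub> F.gram_det n y (y(k := D (y k))))"
      by (rule F.derivation_gram_det[OF d d_add d_mult Dc d_form y])
    ultimately show ?thesis by (simp only: h)
  qed
  show ?thesis
    using F.derivation_genideal[OF H d d_add d_mult gen[unfolded discriminant_ideal_def]
        a[unfolded discriminant_ideal_def]]
    by (simp only: discriminant_ideal_def)
qed

section \<open>Hamiltonian derivations of the specialization\<close>

lemma regular_element_cancel:
  assumes "ring R" "regular_element R c" "u \<in> carrier R" "v \<in> carrier R" "c \<otimes>\<^bsub>R\<^esub> u = c \<otimes>\<^bsub>R\<^esub> v"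
  shows "u = v"
proof -
  interpret ring R by fact
  have c: "c \<in> carrier R" using assms(2) by (simp add: regular_element_def)
  have "c \<otimes>\<^bsub>R\<^esub> (u \<ominus>\<^bsub>R\<^esub> v) = c \<otimes>\<^bsub>R\<^esub> u \<ominus>\<^bsub>R\<^esub> c \<otimes>\<^bsub>R\<^esub> v" using c assms(3,4) by algebra
  also have "\<dots> = \<zero>\<^bsub>R\<^esub>" unfolding assms(5) using c assms(4) by (simp add: r_neg minus_eq)
  finally have "u \<ominus>\<^bsub>R\<^esub> v = \<zero>\<^bsub>R\<^esub>"
    using assms(2-4) unfolding regular_element_def by blast
  then show ?thesis using r_right_minus_eq[OF assms(3,4)] by simp
qed

lemma spec_proj_hom:
  assumes "ring R" "c \<in> ring_center R"
  shows "spec_proj R c \<in> ring_hom R (specialization R c)"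
proof -
  interpret I: ideal "multiples R c" R by (rule multiples_ideal) fact+
  show ?thesis using I.rcos_ring_hom unfolding specialization_def spec_proj_def .
qed

lemma spec_proj_image: "spec_proj R c ` carrier R = carrier (specialization R c)"
  by (auto simp: specialization_def spec_proj_def FactRing_def A_RCOSETS_def')

lemma specialization_ring:
  assumes "ring R" "c \<in> ring_center R"
  shows "ring (specialization R c)"
  unfolding specialization_def by (rule ideal.quotient_is_ring[OF multiples_ideal[OF assms]])

text \<open>In contrast to \<open>spec_bracket_unique\<close>, only \<open>b\<close> is central
  modulo \<open>c\<close>, which lets the bracket with \<open>b\<close> act on the whole
  specialization. Changing the lift \<open>x\<close> by a multiple \<open>c \<otimes> a\<close>
  changes the commutator by \<open>c\<close> times that of \<open>a\<close> and \<open>b\<close>,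
  itself a multiple of \<open>c\<close>; so cancelling \<open>c\<close> changes the quotient only by
  a multiple of \<open>c\<close>.\<close>

lemma spec_commutator_quotient_unique:
  assumes "ring R" and c: "c \<in> ring_center R" and reg: "regular_element R c"
    and x: "x \<in> carrier R" "x' \<in> carrier R" and b: "b \<in> carrier R" and y: "y \<in> carrier R" "y' \<in> carrier R"
    and central: "spec_proj R c b \<in> ring_center (specialization R c)"
    and same: "spec_proj R c x' = spec_proj R c x"
    and eq: "x \<otimes>\<^bsub>R\<^esub> b \<ominus>\<^bsub>R\<^esub> b \<otimes>\<^bsub>R\<^esub> x = c \<otimes>\<^bsub>R\<^esub> y" and eq': "x' \<otimes>\<^bsub>R\<^esub> b \<ominus>\<^bsub>R\<^esub> b \<otimes>\<^bsub>R\<^esub> x' = c \<otimes>\<^bsub>R\<^esub> y'"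
  shows "spec_proj R c y' = spec_proj R c y"
proof -
  interpret ring R by fact
  have cc: "c \<in> carrier R" and comm: "c \<otimes>\<^bsub>R\<^esub> b = b \<otimes>\<^bsub>R\<^esub> c"
    using c b by (auto simp: ring_center_def)
  obtain a where a: "a \<in> carrier R" "x' = x \<oplus>\<^bsub>R\<^esub> c \<otimes>\<^bsub>R\<^esub> a"
    using same spec_proj_eq_iff[OF assms(1) c x(2,1)] by blast
  obtain e where e: "e \<in> carrier R" "b \<otimes>\<^bsub>R\<^esub> a \<ominus>\<^bsub>R\<^esub> a \<otimes>\<^bsub>R\<^esub> b = c \<otimes>\<^bsub>R\<^esub> e"
    using spec_commutator[OF assms(1) c b a(1) central] by blast
  have bca: "b \<otimes>\<^bsub>R\<^esub> (c \<otimes>\<^bsub>R\<^esub> a) = c \<otimes>\<^bsub>R\<^esub> (b \<otimes>\<^bsub>R\<^esub> a)"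
    using cc b a(1) comm by (metis m_assoc)
  have "c \<otimes>\<^bsub>R\<^esub> y' = (x \<otimes>\<^bsub>R\<^esub> b \<oplus>\<^bsub>R\<^esub> c \<otimes>\<^bsub>R\<^esub> (a \<otimes>\<^bsub>R\<^esub> b)) \<ominus>\<^bsub>R\<^esub> (b \<otimes>\<^bsub>R\<^esub> x \<oplus>\<^bsub>R\<^esub> c \<otimes>\<^bsub>R\<^esub> (b \<otimes>\<^bsub>R\<^esub> a))"
    unfolding eq'[symmetric] a(2) using cc b a(1) x bca by (simp add: l_distr r_distr m_assoc)
  also have "\<dots> = (x \<otimes>\<^bsub>R\<^esub> b \<ominus>\<^bsub>R\<^esub> b \<otimes>\<^bsub>R\<^esub> x) \<ominus>\<^bsub>R\<^esub> c \<otimes>\<^bsub>R\<^esub> (b \<otimes>\<^bsub>R\<^esub> a \<ominus>\<^bsub>R\<^esub> a \<otimes>\<^bsub>R\<^esub> b)"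
    using cc b a(1) x by algebra
  also have "\<dots> = c \<otimes>\<^bsub>R\<^esub> y \<ominus>\<^bsub>R\<^esub> c \<otimes>\<^bsub>R\<^esub> (c \<otimes>\<^bsub>R\<^esub> e)" by (simp only: eq e(2))
  also have "\<dots> = c \<otimes>\<^bsub>R\<^esub> (y \<oplus>\<^bsub>R\<^esub> c \<otimes>\<^bsub>R\<^esub> (\<ominus>\<^bsub>R\<^esub> e))"
    using cc e(1) y by algebra
  finally have "c \<otimes>\<^bsub>R\<^esub> y' = c \<otimes>\<^bsub>R\<^esub> (y \<oplus>\<^bsub>R\<^esub> c \<otimes>\<^bsub>R\<^esub> (\<ominus>\<^bsub>R\<^esub> e))" .
  moreover have "y \<oplus>\<^bsub>R\<^esub> c \<otimes>\<^bsub>R\<^esub> (\<ominus>\<^bsub>R\<^esub> e) \<in> carrier R"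
    using cc e(1) y(1) by simp
  ultimately have "y' = y \<oplus>\<^bsub>R\<^esub> c \<otimes>\<^bsub>R\<^esub> (\<ominus>\<^bsub>R\<^esub> e)"
    by (rule regular_element_cancel[OF assms(1) reg y(2), rotated])
  then show ?thesis
    unfolding spec_proj_eq_iff[OF assms(1) c y(2,1)] by (rule bexI[OF _ a_inv_closed[OF e(1)]])
qed

text \<open>The commutator with \<open>b\<close> is a derivation of \<open>R\<close>. Its values are
  divisible by \<open>c\<close>, as \<open>b\<close> is central modulo \<open>c\<close>, and
  division by a central regular element keeps the product rule. The condition on
  \<open>\<iota>\<close> yields linearity: a scalar has a central lift, whose commutator with
  \<open>b\<close> vanishes.\<close>

lemma hamiltonian_derivation:
  assumes "ring R" and c: "c \<in> ring_center R" and reg: "regular_element R c"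
    and b: "b \<in> carrier R" and central: "spec_proj R c b \<in> ring_center (specialization R c)"
    and \<iota>: "\<And>a. a \<in> carrier K \<Longrightarrow> \<iota> a \<in> spec_proj R c ` ring_center R"
  obtains D where "derivation K (specialization R c) \<iota> D"
    and "\<And>z. z \<in> ring_center (specialization R c) \<Longrightarrow> D z = spec_bracket R c z (spec_proj R c b)"
proof -
  interpret ring R by fact
  let ?S = "specialization R c" and ?\<sigma> = "spec_proj R c"
  interpret S: ring ?S by (rule specialization_ring) fact+
  have cc: "c \<in> carrier R" and comm: "\<And>x. x \<in> carrier R \<Longrightarrow> x \<otimes>\<^bsub>R\<^esub> c = c \<otimes>\<^bsub>R\<^esub> x"
    using c by (auto simp: ring_center_def)
  note hom = spec_proj_hom[OF assms(1) c]
  note \<sigma>_closed = ring_hom_closed[OF hom] and \<sigma>_add = ring_hom_add[OF hom]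
    and \<sigma>_mult = ring_hom_mult[OF hom]
  \<comment> \<open>Working with this relation between lifts settles sums and products in
    \<open>R\<close> before any choice of lift is made.\<close>
  define Q where "Q x y \<longleftrightarrow> x \<in> carrier R \<and> y \<in> carrier R \<and> x \<otimes>\<^bsub>R\<^esub> b \<ominus>\<^bsub>R\<^esub> b \<otimes>\<^bsub>R\<^esub> x = c \<otimes>\<^bsub>R\<^esub> y" for x y
  have Q_ex: "\<exists>y. Q x y" if x: "x \<in> carrier R" for x
  proof -
    \<comment> \<open>\<open>spec_commutator\<close> takes the element that is central modulo
      \<open>c\<close> first, hence the opposite commutator and the sign change.\<close>
    obtain e where e: "e \<in> carrier R" "b \<otimes>\<^bsub>R\<^esub> x \<ominus>\<^bsub>R\<^esub> x \<otimes>\<^bsub>R\<^esub> b = c \<otimes>\<^bsub>R\<^esub> e"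
      using spec_commutator[OF assms(1) c b x central] by blast
    have "x \<otimes>\<^bsub>R\<^esub> b \<ominus>\<^bsub>R\<^esub> b \<otimes>\<^bsub>R\<^esub> x = \<ominus>\<^bsub>R\<^esub> (b \<otimes>\<^bsub>R\<^esub> x \<ominus>\<^bsub>R\<^esub> x \<otimes>\<^bsub>R\<^esub> b)"
      using x b by algebra
    also have "\<dots> = c \<otimes>\<^bsub>R\<^esub> (\<ominus>\<^bsub>R\<^esub> e)" unfolding e(2) using cc e(1) by algebra
    finally show ?thesis using x e(1) unfolding Q_def by blast
  qed
  \<comment> \<open>The choice is harmless: by \<open>D_eq\<close> the class of \<open>y\<close>
    depends only on \<open>z\<close>.\<close>
  define D where "D z = ?\<sigma> (SOME y. \<exists>x. Q x y \<and> ?\<sigma> x = z)" for z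
  have D_eq: "D (?\<sigma> x) = ?\<sigma> y" if Q: "Q x y" for x y
  proof -
    have "\<exists>x'. Q x' (SOME y. \<exists>x'. Q x' y \<and> ?\<sigma> x' = ?\<sigma> x) \<and> ?\<sigma> x' = ?\<sigma> x"
      using Q by (intro someI_ex[where P = "\<lambda>y. \<exists>x'. Q x' y \<and> ?\<sigma> x' = ?\<sigma> x"]) blast
    then obtain x' y' where "Q x' y'" "?\<sigma> x' = ?\<sigma> x" "D (?\<sigma> x) = ?\<sigma> y'"
      unfolding D_def by blast
    then show ?thesis
      using spec_commutator_quotient_unique[OF assms(1) c reg _ _ b _ _ central] Q
      unfolding Q_def by metis
  qed
  have lift: "\<exists>x y. Q x y \<and> z = ?\<sigma> x" if "z \<in> carrier ?S" for z
    using that Q_ex unfolding spec_proj_image[symmetric] by blast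
  have Q_add: "Q (x \<oplus>\<^bsub>R\<^esub> x') (y \<oplus>\<^bsub>R\<^esub> y')" if "Q x y" "Q x' y'" for x y x' y'
  proof -
    note q = that[unfolded Q_def]
    have carr: "x \<in> carrier R" "x' \<in> carrier R" using q by auto
    have "(x \<oplus>\<^bsub>R\<^esub> x') \<otimes>\<^bsub>R\<^esub> b \<ominus>\<^bsub>R\<^esub> b \<otimes>\<^bsub>R\<^esub> (x \<oplus>\<^bsub>R\<^esub> x')
        = (x \<otimes>\<^bsub>R\<^esub> b \<ominus>\<^bsub>R\<^esub> b \<otimes>\<^bsub>R\<^esub> x) \<oplus>\<^bsub>R\<^esub> (x' \<otimes>\<^bsub>R\<^esub> b \<ominus>\<^bsub>R\<^esub> b \<otimes>\<^bsub>R\<^esub> x')"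
      using carr b by algebra
    then show ?thesis using q cc by (simp add: Q_def r_distr)
  qed
  have Q_mult: "Q (x \<otimes>\<^bsub>R\<^esub> x') (y \<otimes>\<^bsub>R\<^esub> x' \<oplus>\<^bsub>R\<^esub> x \<otimes>\<^bsub>R\<^esub> y')" if "Q x y" "Q x' y'" for x y x' y'
  proof -
    note q = that[unfolded Q_def]
    have carr: "x \<in> carrier R" "x' \<in> carrier R" using q by auto
    have "(x \<otimes>\<^bsub>R\<^esub> x') \<otimes>\<^bsub>R\<^esub> b \<ominus>\<^bsub>R\<^esub> b \<otimes>\<^bsub>R\<^esub> (x \<otimes>\<^bsub>R\<^esub> x')
        = (x \<otimes>\<^bsub>R\<^esub> b \<ominus>\<^bsub>R\<^esub> b \<otimes>\<^bsub>R\<^esub> x) \<otimes>\<^bsub>R\<^esub> x' \<oplus>\<^bsub>R\<^esub> x \<otimes>\<^bsub>R\<^esub> (x' \<otimes>\<^bsub>R\<^esub> b \<ominus>\<^bsub>R\<^esub> b \<otimes>\<^bsub>R\<^esub> x')"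
      using carr b by algebra
    also have "\<dots> = (c \<otimes>\<^bsub>R\<^esub> y) \<otimes>\<^bsub>R\<^esub> x' \<oplus>\<^bsub>R\<^esub> x \<otimes>\<^bsub>R\<^esub> (c \<otimes>\<^bsub>R\<^esub> y')" using q by simp
    also have "x \<otimes>\<^bsub>R\<^esub> (c \<otimes>\<^bsub>R\<^esub> y') = c \<otimes>\<^bsub>R\<^esub> (x \<otimes>\<^bsub>R\<^esub> y')"
      using q cc comm by (metis m_assoc)
    finally show ?thesis using q cc by (simp add: Q_def r_distr m_assoc)
  qed
  \<comment> \<open>Together with \<open>Q_mult\<close> this gives linearity over the scalars, as
    the term differentiating the scalar vanishes.\<close>
  have Q_central: "Q h \<zero>\<^bsub>R\<^esub>" if "h \<in> ring_center R" for h
    using that b cc by (simp add: Q_def ring_center_def minus_eq r_neg)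
  have der: "derivation K ?S \<iota> D"
    unfolding derivation_def
  proof (intro conjI ballI funcsetI)
    fix z assume "z \<in> carrier ?S"
    then obtain x y where q: "Q x y" "z = ?\<sigma> x" using lift by blast
    then show "D z \<in> carrier ?S" using D_eq[OF q(1)] \<sigma>_closed by (auto simp: Q_def)
    fix z' assume "z' \<in> carrier ?S"
    then obtain x' y' where q': "Q x' y'" "z' = ?\<sigma> x'" using lift by blast
    note Qs = q(1)[unfolded Q_def] q'(1)[unfolded Q_def]
    show "D (z \<oplus>\<^bsub>?S\<^esub> z') = D z \<oplus>\<^bsub>?S\<^esub> D z'"
      using D_eq[OF Q_add[OF q(1) q'(1)]] Qs
      by (simp add: q(2) q'(2) D_eq[OF q(1)] D_eq[OF q'(1)] \<sigma>_add)
    show "D (z \<otimes>\<^bsub>?S\<^esub> z') = D z \<otimes>\<^bsub>?S\<^esub> z' \<oplus>\<^bsub>?S\<^esub> z \<otimes>\<^bsub>?S\<^esub> D z'"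
      using D_eq[OF Q_mult[OF q(1) q'(1)]] Qs
      by (simp add: q(2) q'(2) D_eq[OF q(1)] D_eq[OF q'(1)] \<sigma>_add \<sigma>_mult)
  next
    fix a z assume a: "a \<in> carrier K" and "z \<in> carrier ?S"
    then obtain x y where q: "Q x y" "z = ?\<sigma> x" using lift by blast
    obtain h where h: "h \<in> ring_center R" "\<iota> a = ?\<sigma> h" using \<iota>[OF a] by blast
    have hc: "h \<in> carrier R" using h(1) by (simp add: ring_center_def)
    show "D (\<iota> a \<otimes>\<^bsub>?S\<^esub> z) = \<iota> a \<otimes>\<^bsub>?S\<^esub> D z"
      using D_eq[OF Q_mult[OF Q_central[OF h(1)] q(1)]] q(1)[unfolded Q_def] hc
      by (simp add: q(2) h(2) D_eq[OF q(1)] \<sigma>_mult)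
  qed
  have "D z = spec_bracket R c z (?\<sigma> b)" if z: "z \<in> ring_center ?S" for z
  proof -
    have "z \<in> carrier ?S" using z by (simp add: ring_center_def)
    then obtain x y where q: "Q x y" "z = ?\<sigma> x" using lift by blast
    note Qs = q(1)[unfolded Q_def]
    \<comment> \<open>For central \<open>z\<close>, the relation \<open>Q x y\<close> is the
      equation defining the bracket.\<close>
    have "spec_bracket R c (?\<sigma> x) (?\<sigma> b) = ?\<sigma> y"
      using Qs z central b unfolding q(2)
      by (intro spec_bracket_unique[OF assms(1) c reg]) auto
    then show ?thesis by (simp add: q(2) D_eq[OF q(1)])
  qed
  with der show thesis by (rule that)
qed

section \<open>The specialization at \<open>q = \<epsilon>\<close>\<close>

lemma laurent_monom_closed:
  assumes "ring K" "a \<in> carrier K"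
  shows "laurent_monom K a n \<in> carrier (laurent_ring K)"
proof -
  interpret ring K by fact
  have "finite {i. laurent_monom K a n i \<noteq> \<zero>\<^bsub>K\<^esub>}"
    by (rule finite_subset[of _ "{n}"]) (auto simp: laurent_monom_def)
  then show ?thesis using assms(2) by (simp add: laurent_ring_def laurent_monom_def)
qed

lemma ring_center_minus:
  assumes "ring R" "x \<in> ring_center R" "y \<in> ring_center R"
  shows "x \<ominus>\<^bsub>R\<^esub> y \<in> ring_center R"
proof -
  interpret ring R by fact
  show ?thesis
    using assms(2,3) by (simp add: ring_center_def minus_eq l_distr r_distr l_minus r_minus)
qed

theorem theorem3p6:
  fixes K :: "('k, 'm) ring_scheme" and R :: "('r, 'n) ring_scheme"
    and \<eta> :: "(int \<Rightarrow> 'k) \<Rightarrow> 'r" and \<epsilon> :: 'k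
    and C :: "'r set set" and tr :: "'r set \<Rightarrow> 'r set"
  defines "c \<equiv> q_minus K R \<eta> \<epsilon>"
  defines "S \<equiv> specialization R c"
    and "\<iota> \<equiv> spec_scalar K R \<eta> \<epsilon>"
    and "br \<equiv> spec_bracket R c"
  assumes "field K" and "infinite (carrier K)"
    and "laurent_algebra K R \<eta>"
    and "\<epsilon> \<in> carrier K" and "\<epsilon> \<noteq> \<zero>\<^bsub>K\<^esub>"
    and "regular_element R c"
    and "central_poisson_subalgebra K S \<iota> br C"
    and "trace_function S C tr"
    and "\<And>D. derivation K S \<iota> D \<Longrightarrow> D ` C \<subseteq> C \<Longrightarrow> commutes_with_trace S tr D"
  shows "\<forall>n>0. poisson_ideal S br C (discriminant_ideal S C tr n) \<and>
    (\<forall>D. derivation K S \<iota> D \<and> D ` C \<subseteq> C \<longrightarrow>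
      D ` discriminant_ideal S C tr n \<subseteq> discriminant_ideal S C tr n)"
proof (intro allI impI)
  fix n :: nat
  let ?I = "discriminant_ideal S C tr n"
  interpret K: field K by fact
  have R: "ring R" and central: "\<And>f. f \<in> carrier (laurent_ring K) \<Longrightarrow> \<eta> f \<in> ring_center R"
    using assms(7) by (auto simp: laurent_algebra_def)
  have monom: "\<eta> (laurent_monom K a i) \<in> ring_center R" if "a \<in> carrier K" for a i
    by (intro central laurent_monom_closed K.ring_axioms that)
  have c: "c \<in> ring_center R"
    unfolding c_def q_minus_def using assms(8) by (intro ring_center_minus[OF R] monom) auto
  have S: "ring S" unfolding S_def by (rule specialization_ring[OF R c])
  have C: "subring C S" "C \<subseteq> ring_center S" and br: "\<And>a b. a \<in> C \<Longrightarrow> b \<in> C \<Longrightarrow> br a b \<in> C"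
    using assms(11) by (auto simp: central_poisson_subalgebra_def)
  \<comment> \<open>This is the second assertion; the Poisson property is reduced to it through a
    Hamiltonian derivation.\<close>
  have stable: "D a \<in> ?I" if "derivation K S \<iota> D" "D ` C \<subseteq> C" "a \<in> ?I" for D a
    using discriminant_ideal_derivation[OF S C assms(12) that(1,2) assms(13)[OF that(1,2)] that(3)] .
  have ideal: "ideal ?I (S\<lparr>carrier := C\<rparr>)"
    by (rule discriminant_ideal_is_ideal(1)[OF S C assms(12)])
  then have I_C: "?I \<subseteq> C"
    using additive_subgroup.a_subset[OF ideal.axioms(1)[OF ideal]] by simp
  have "br a b \<in> ?I" if a: "a \<in> ?I" and b: "b \<in> C" for a b
  proof -
    have "b \<in> ring_center S" using b C(2) by blast
    then have "b \<in> spec_proj R c ` carrier R"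
      unfolding spec_proj_image S_def by (simp add: ring_center_def)
    then obtain b' where b': "b' \<in> carrier R" "b = spec_proj R c b'" by blast
    \<comment> \<open>Scalars of \<open>S\<close> are images of constant Laurent monomials, which
      \<open>\<eta>\<close> sends into the center of \<open>R\<close>.\<close>
    have \<iota>: "\<iota> a \<in> spec_proj R c ` ring_center R" if "a \<in> carrier K" for a
      using monom[OF that] unfolding \<iota>_def spec_scalar_def c_def by blast
    obtain D where D: "derivation K S \<iota> D" "\<And>z. z \<in> ring_center S \<Longrightarrow> D z = br z b"
      using hamiltonian_derivation[OF R c assms(10) b'(1), of K \<iota>] \<iota> \<open>b \<in> ring_center S\<close>
      unfolding S_def br_def b'(2) by blast
    have eq: "D z = br z b" if "z \<in> C" for z using D(2) that C(2) by blast
    \<comment> \<open>Closure of \<open>C\<close> under the bracket makes \<open>D\<close> preserve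
      \<open>C\<close>, so the hypothesis on the trace applies to \<open>D\<close>.\<close>
    then have "D ` C \<subseteq> C" using br b by auto
    then have "D a \<in> ?I" by (rule stable[OF D(1) _ a])
    then show ?thesis using eq a I_C by auto
  qed
  then show "poisson_ideal S br C ?I \<and>
      (\<forall>D. derivation K S \<iota> D \<and> D ` C \<subseteq> C \<longrightarrow> D ` ?I \<subseteq> ?I)"
    using ideal stable by (auto simp: poisson_ideal_def)
qed

end
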